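(* Let $k$ be a field and let $D$ be a finitely generated division algebra over $k$. If $E$ is a division subalgebra of $D$ with the property that $D$ is infinite-dimensional as a left $E$-vector space, then $\mathrm{Ld}^*(D)\ge \mathrm{Ld}(E)+1$.
   Context: Division algebras and division subalgebras are over $k$ (so $E\supseteq k$); "finitely generated division algebra over $k$" means generated as a division algebra over $k$ by finitely many elements. Let $A$ be a $k$-algebra that is a domain. A subframe of $A$ is a finite-dimensional $k$-subspace of $A$ containing $1$. For a subframe $V$ of $A$, $\mathrm{VDI}(V)\in[0,\infty]$ is the supremum of all real $d>0$ for which there is a constant $C>0$ with $\dim_k(VW)\ge \dim_k(W)+C\,(\dim_k W)^{(d-1)/d}$ for every subframe $W$ of $A$ (and $\mathrm{VDI}(V)=0$ if there is no such $d$). The lower transcendence degree is $\mathrm{Ld}(A)=\sup_V \mathrm{VDI}(V)$ over all subframes $V$ of $A$. Similarly, $\mathrm{VDI}^*(V)$ is the supremum of all real $d>0$ for which there is a constant $C>0$ with $\max(\dim_k(VW),\dim_k(WV))\ge \dim_k(W)+C\,(\dim_k W)^{(d-1)/d}$ for every subframe $W$ of $A$ (and $0$ if there is no such $d$), and the strong lower transcendence degree is $\mathrm{Ld}^*(A)=\sup_V\mathrm{VDI}^*(V)$ over all subframes $V$ of $A$. Here $VW$ is the $k$-span of the products $vw$. *)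

theory Defs
  imports Complex_Main "HOL-Library.Extended_Nonnegative_Real"
begin

text \<open>
  A \<open>k\<close>-algebra structure on a ring without zero divisors: \<open>k\<close> is the field type \<open>'k\<close>, acting by
  \<open>scale\<close>. Both compatibility laws are needed, since together they make \<open>k\<close> act centrally.
  The algebras \<open>A\<close> below are subalgebras of the ambient ring, given by their carrier sets;
  the ambient ring itself is \<open>UNIV\<close>.
\<close>

locale domain_algebra = vector_space scale
  for scale :: "'k::field \<Rightarrow> 'a::ring_1_no_zero_divisors \<Rightarrow> 'a" (infixr "*k" 75) +
  assumes scale_mult_left: "(c *k x) * y = c *k (x * y)"
    and scale_mult_right: "x * (c *k y) = c *k (x * y)"
begin

definition subframe :: "'a set \<Rightarrow> 'a set \<Rightarrow> bool" where
  "subframe A V \<longleftrightarrow>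
     subspace V \<and> (\<exists>B. finite B \<and> span B = V) \<and> V \<subseteq> A \<and> 1 \<in> V"

definition span_prod :: "'a set \<Rightarrow> 'a set \<Rightarrow> 'a set" where
  "span_prod V W = span {v * w | v w. v \<in> V \<and> w \<in> W}"

text \<open>
  The suprema are taken in \<open>ennreal\<close>, that is in \<open>[0, \<infinity>]\<close>, where the supremum of the empty set
  is \<open>0\<close>.
\<close>

definition VDI :: "'a set \<Rightarrow> 'a set \<Rightarrow> ennreal" where
  "VDI A V = Sup {ennreal d | d. d > 0 \<and>
     (\<exists>C>0. \<forall>W. subframe A W \<longrightarrow>
        real (dim (span_prod V W)) \<ge> real (dim W) + C * real (dim W) powr ((d - 1) / d))}"

definition Ld :: "'a set \<Rightarrow> ennreal" where
  "Ld A = (SUP V\<in>{V. subframe A V}. VDI A V)"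

definition VDI_star :: "'a set \<Rightarrow> 'a set \<Rightarrow> ennreal" where
  "VDI_star A V = Sup {ennreal d | d. d > 0 \<and>
     (\<exists>C>0. \<forall>W. subframe A W \<longrightarrow>
        max (real (dim (span_prod V W))) (real (dim (span_prod W V)))
          \<ge> real (dim W) + C * real (dim W) powr ((d - 1) / d))}"

definition Ld_star :: "'a set \<Rightarrow> ennreal" where
  "Ld_star A = (SUP V\<in>{V. subframe A V}. VDI_star A V)"

end

locale division_algebra = domain_algebra scale
  for scale :: "'k::field \<Rightarrow> 'd::division_ring \<Rightarrow> 'd" (infixr "*k" 75)
begin

text \<open>Closure under inverses needs no exception for \<open>0\<close>, because \<open>inverse 0 = 0\<close>.\<close>

definition division_subalgebra :: "'d set \<Rightarrow> bool" where
  "division_subalgebra E \<longleftrightarrow>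
     subspace E \<and> 1 \<in> E \<and> (\<forall>x\<in>E. \<forall>y\<in>E. x * y \<in> E) \<and> (\<forall>x\<in>E. inverse x \<in> E)"

definition finitely_generated_division_algebra :: bool where
  "finitely_generated_division_algebra \<longleftrightarrow>
     (\<exists>S. finite S \<and> division_subalgebra hull S = UNIV)"

end

text \<open>
  Left linear algebra over a division subring \<open>E\<close>, given as a subset of the ambient ring. As \<open>E\<close>
  need not be commutative, the library's vector spaces over a field do not apply.
\<close>

definition left_span :: "'d::division_ring set \<Rightarrow> 'd set \<Rightarrow> 'd set" where
  "left_span E B = {\<Sum>b\<in>S. c b * b | S c. finite S \<and> S \<subseteq> B \<and> (\<forall>b\<in>S. c b \<in> E)}"

definition left_independent :: "'d::division_ring set \<Rightarrow> 'd set \<Rightarrow> bool" where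
  "left_independent E B \<longleftrightarrow>
     (\<forall>S c. finite S \<and> S \<subseteq> B \<and> (\<forall>b\<in>S. c b \<in> E) \<and> (\<Sum>b\<in>S. c b * b) = 0
        \<longrightarrow> (\<forall>b\<in>S. c b = 0))"

definition left_basis :: "'d::division_ring set \<Rightarrow> 'd set \<Rightarrow> 'd set \<Rightarrow> bool" where
  "left_basis E M B \<longleftrightarrow> left_independent E B \<and> left_span E B = M"

definition left_infinite_dimensional :: "'d::division_ring set \<Rightarrow> 'd set \<Rightarrow> bool" where
  "left_infinite_dimensional E M \<longleftrightarrow> \<not> (\<exists>B. finite B \<and> left_basis E M B)"

end

theory Submission
  imports Defs
begin

text \<open>
  Let \<open>V \<subseteq> E\<close> witness the exponent \<open>d\<close> for \<open>E\<close>, and let \<open>W\<close> be a subframe of \<open>D\<close> of dimension \<open>n\<close>.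
  The exponent to be reached in \<open>D\<close> is \<open>d + 1\<close>, that is, growth of order \<open>n powr (d / (d + 1))\<close>.
  Picture \<open>W\<close> as a union of rows, one for each \<open>E\<close>-direction that it occupies: left multiplication
  by \<open>V\<close> lengthens every row, and right multiplication by generators of \<open>D\<close> shifts long rows into
  new directions.  If all rows are short there are many of them, and \<open>V\<close> wins; if some row is long,
  the shift wins.

  The right measure of row length is \<^emph>\<open>thickness\<close>: a subspace \<open>Z\<close> is \<open>t\<close>-thick if its image in \<open>D / H\<close>
  is zero or of dimension at least \<open>t\<close>, for every left \<open>E\<close>-submodule \<open>H\<close>.  Let \<open>t\<close> be the largest
  thickness of a nonzero subspace of \<open>W\<close>.

  \<^item> Since \<open>W\<close> has no nonzero \<open>(t + 1)\<close>-thick subspace, one can peel off from \<open>W\<close>, again and again,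
    a quotient of dimension \<open>p \<le> t\<close> lying on a single line \<open>E w\<close>.  On it \<open>V\<close> gains at least
    \<open>C * p powr ((d - 1) / d) \<ge> C * p * t powr (- 1 / d)\<close>, which adds up to \<open>C * n * t powr (- 1 / d)\<close>
    (\<open>growth_left\<close>).
  \<^item> A finitely generated nonzero left \<open>E\<close>-submodule of \<open>D\<close> cannot be stable under right multiplication
    by the generators of \<open>D\<close>: being of finite length it would be stable under their inverses too, hence
    under all of \<open>D\<close>, hence equal to \<open>D\<close> (\<open>exists_moving_subframe\<close>).  So a suitable subframe \<open>U\<close> moves
    the \<open>t\<close>-thick part of \<open>W\<close> into layers of lesser thickness, and the gains in all the layers add up
    to at least \<open>t\<close> (\<open>growth_right\<close>).

  If \<open>t \<ge> n powr (d / (d + 1))\<close> the second gain suffices, otherwise the first one does; the subframe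
  spanned by \<open>V\<close> and \<open>U\<close> has both.  As \<open>t \<ge> 1\<close> always, the second gain alone shows that
  \<open>Ld_star\<close> is at least \<open>1\<close>, which covers the case that no exponent \<open>d\<close> exists for \<open>E\<close>.
\<close>

section \<open>Finite-dimensional subspaces of a vector space\<close>

text \<open>A name of its own for plain vector spaces: definitions made in \<open>vector_space\<close> itself would be
  captured by its global interpretation for real vector spaces.\<close>

locale subspace_dimension = vector_space scale
  for scale :: "'k::field \<Rightarrow> 'b::ab_group_add \<Rightarrow> 'b" (infixr "*s" 75)
begin

definition fin_dim :: "'b set \<Rightarrow> bool" where
  "fin_dim V \<longleftrightarrow> subspace V \<and> (\<exists>B. finite B \<and> span B = V)"

text \<open>The dimension of the image of \<open>A\<close> in the quotient by \<open>H\<close>, where \<open>A\<close> is finite-dimensional and \<open>H\<close>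
  a subspace of any dimension.\<close>

definition dim_mod :: "'b set \<Rightarrow> 'b set \<Rightarrow> nat" where
  "dim_mod A H = dim A - dim (A \<inter> H)"

lemma fin_dim_subspace: "fin_dim V \<Longrightarrow> subspace V"
  by (simp add: fin_dim_def)

lemma fin_dim_span: "finite B \<Longrightarrow> fin_dim (span B)"
  by (auto simp: fin_dim_def)

lemma fin_dim_basis_extend:
  assumes "fin_dim V" "S \<subseteq> V" "independent S"
  obtains B where "S \<subseteq> B" "B \<subseteq> V" "independent B" "span B = V" "finite B" "card B = dim V"
proof -
  obtain B where B: "S \<subseteq> B" "B \<subseteq> V" "independent B" "V \<subseteq> span B"
    using maximal_independent_subset_extend assms by metis
  obtain T where T: "finite T" "span T = V" using assms by (auto simp: fin_dim_def)
  have "finite B" using independent_span_bound[OF T(1) B(3)] B T by auto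
  moreover have "span B = V"
    by (simp add: B assms(1) fin_dim_subspace span_subspace)
  ultimately show ?thesis using that B basis_card_eq_dim by blast
qed

lemma fin_dim_basis:
  assumes "fin_dim V"
  obtains B where "B \<subseteq> V" "independent B" "span B = V" "finite B" "card B = dim V"
  using fin_dim_basis_extend[OF assms, of "{}"] independent_empty by auto

lemma fin_dim_subset:
  assumes "fin_dim V" "subspace S" "S \<subseteq> V"
  shows "fin_dim S"
proof -
  obtain B where B: "B \<subseteq> S" "independent B" "S \<subseteq> span B"
    using maximal_independent_subset by blast
  then have "finite B" using fin_dim_basis_extend[OF assms(1), of B] assms(3)
    by (metis finite_subset order_trans)
  moreover have "span B = S" by (simp add: B assms(2) span_subspace)
  ultimately show ?thesis using assms by (auto simp: fin_dim_def)
qed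

lemma fin_dim_Int: "fin_dim V \<Longrightarrow> subspace S \<Longrightarrow> fin_dim (V \<inter> S)"
  by (rule fin_dim_subset[of V]) (auto intro: subspace_inter fin_dim_subspace)

lemma fin_dim_span_Un: "fin_dim A \<Longrightarrow> fin_dim B \<Longrightarrow> fin_dim (span (A \<union> B))"
proof -
  assume "fin_dim A" "fin_dim B"
  then obtain S T where "finite S" "span S = A" "finite T" "span T = B"
    by (auto simp: fin_dim_def)
  moreover have "span (span S \<union> span T) = span (S \<union> T)"
    by (simp only: span_Un span_span)
  ultimately have "span (A \<union> B) = span (S \<union> T)" "finite (S \<union> T)"
    by auto
  then show ?thesis by (metis fin_dim_span)
qed

lemma dim_subset_fin_dim: "fin_dim V \<Longrightarrow> S \<subseteq> V \<Longrightarrow> dim S \<le> dim V"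
  by (metis fin_dim_basis dim_le_card)

lemma dim_eq_0_fin_dim:
  assumes "fin_dim V"
  shows "dim V = 0 \<longleftrightarrow> V = {0}"
proof
  assume "dim V = 0"
  with assms show "V = {0}" using fin_dim_basis[of V] by (metis card_0_eq span_empty)
next
  assume "V = {0}"
  then show "dim V = 0" using dim_span[of "{}"] dim_eq_card_independent[OF independent_empty] by simp
qed

lemma span_Un_mem:
  assumes "subspace A" "subspace B"
  shows "x \<in> span (A \<union> B) \<longleftrightarrow> (\<exists>a\<in>A. \<exists>b\<in>B. x = a + b)"
proof -
  have "span A = A" "span B = B" using assms by auto
  then show ?thesis unfolding span_Un by blast
qed

text \<open>The basis exchange behind the dimension formula for sums: if a vector of \<open>T - I\<close> depended on the
  others, its component in \<open>A\<close> would lie in \<open>A \<inter> B\<close>, making \<open>T\<close> dependent.\<close>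

lemma independent_Un_fin_dim:
  assumes A: "fin_dim A" and B: "fin_dim B"
    and I: "span I = A \<inter> B"
    and S: "I \<subseteq> S" "independent S" "span S = A"
    and T: "I \<subseteq> T" "independent T" "span T = B" "finite T"
  shows "independent (S \<union> (T - I))"
proof -
  have "independent (S \<union> T')" if "finite T'" "T' \<subseteq> T - I" for T'
    using that
  proof (induction T' rule: finite_induct)
    case (insert b T')
    have "b \<notin> span (S \<union> T')"
    proof
      assume "b \<in> span (S \<union> T')"
      then obtain a s where as: "a \<in> A" "s \<in> span T'" "b = a + s"
        unfolding span_Un using S by auto
      have "s \<in> B" "b \<in> B" using as insert.prems T span_mono[of T' T] span_base by auto
      then have "a \<in> B" using as B fin_dim_subspace subspace_diff[of B b s] by auto
      then have "a \<in> span I" using as I by auto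
      then have "b \<in> span (I \<union> T')" using as by (auto simp: span_Un)
      moreover have "I \<union> T' \<subseteq> T - {b}" using insert T by auto
      ultimately have "b \<in> span (T - {b})" using span_mono by blast
      then show False using T insert by (auto simp: dependent_def)
    qed
    then show ?case using insert independent_insertI by auto
  qed (use S in simp)
  then show ?thesis using T by auto
qed

lemma dim_span_Un:
  assumes A: "fin_dim A" and B: "fin_dim B"
  shows "dim (span (A \<union> B)) + dim (A \<inter> B) = dim A + dim B"
proof -
  have AB: "fin_dim (A \<inter> B)" using A B fin_dim_Int fin_dim_subspace by auto
  obtain I where I: "I \<subseteq> A \<inter> B" "independent I" "span I = A \<inter> B" "finite I" "card I = dim (A \<inter> B)"
    using fin_dim_basis[OF AB] .
  obtain S where S: "I \<subseteq> S" "S \<subseteq> A" "independent S" "span S = A" "finite S" "card S = dim A"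
    using fin_dim_basis_extend[OF A] I by (metis le_inf_iff)
  obtain T where T: "I \<subseteq> T" "T \<subseteq> B" "independent T" "span T = B" "finite T" "card T = dim B"
    using fin_dim_basis_extend[OF B] I by (metis le_inf_iff)
  have ind: "independent (S \<union> (T - I))"
    using independent_Un_fin_dim[OF A B I(3)] S T by auto
  have "span (A \<union> B) = span (S \<union> T)" unfolding S(4)[symmetric] T(4)[symmetric] by (simp only: span_Un span_span)
  also have "S \<union> T = S \<union> (T - I)" using S by auto
  finally have "dim (span (A \<union> B)) = card (S \<union> (T - I))"
    using ind dim_eq_card_independent by simp
  moreover have "S \<inter> (T - I) = {}"
  proof (safe, rule ccontr)
    fix x assume x: "x \<in> S" "x \<in> T" "x \<notin> I"
    then have "x \<in> span I" using S T I by auto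
    then have "x \<in> span (T - {x})" using span_mono[of I "T - {x}"] T x by auto
    then show False using T x by (auto simp: dependent_def)
  qed
  ultimately have "dim (span (A \<union> B)) = card S + card (T - I)"
    using S T by (simp add: card_Un_disjoint)
  moreover have "card (T - I) + card I = card T"
    by (metis T(1,5) I(4) card_Diff_subset card_mono le_add_diff_inverse2)
  ultimately show ?thesis using S T I by simp
qed

text \<open>The dimension modulo \<open>H\<close> only depends, monotonically, on the image in the quotient by \<open>H\<close>.  This is
  the form in which quotients are compared below without ever being formed.\<close>

lemma dim_mod_le:
  assumes A: "fin_dim A" and B: "fin_dim B" and H: "subspace H"
    and AB: "\<And>a. a \<in> A \<Longrightarrow> \<exists>b\<in>B. a - b \<in> H"
  shows "dim_mod A H \<le> dim_mod B H"
proof -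
  \<comment> \<open>The possibly infinite-dimensional \<open>H\<close> may be cut down to its part inside \<open>A + B\<close>.\<close>
  define K where "K = span (A \<union> B) \<inter> H"
  have K: "fin_dim K" using A B H by (auto simp: K_def intro: fin_dim_Int fin_dim_span_Un)
  have AK: "A \<inter> K = A \<inter> H" "B \<inter> K = B \<inter> H" by (auto simp: K_def span_base)
  have sub: "subspace A" "subspace B" "subspace K" using A B K fin_dim_subspace by auto
  have "A \<subseteq> span (B \<union> K)"
  proof
    fix a assume a: "a \<in> A"
    then obtain b where b: "b \<in> B" "a - b \<in> H" using AB by blast
    then have "a - b \<in> K" using a by (auto simp: K_def intro: span_diff span_base)
    then show "a \<in> span (B \<union> K)" using b sub unfolding span_Un_mem[OF sub(2,3)]
      by (intro bexI[of _ b] bexI[of _ "a - b"]) auto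
  qed
  then have "span (A \<union> K) \<subseteq> span (B \<union> K)"
    by (intro span_minimal) (auto intro: span_base)
  then have "dim (span (A \<union> K)) \<le> dim (span (B \<union> K))"
    using B K fin_dim_span_Un dim_subset_fin_dim by blast
  then show ?thesis
    using dim_span_Un[OF A K] dim_span_Un[OF B K] by (simp add: dim_mod_def AK)
qed

lemma dim_mod_mono: "fin_dim B \<Longrightarrow> fin_dim A \<Longrightarrow> A \<subseteq> B \<Longrightarrow> subspace H \<Longrightarrow> dim_mod A H \<le> dim_mod B H"
  by (rule dim_mod_le) (auto intro!: bexI simp: subspace_0)

lemma dim_mod_anti:
  assumes "fin_dim A" "subspace H'" "H \<subseteq> H'"
  shows "dim_mod A H' \<le> dim_mod A H"
proof -
  have "dim (A \<inter> H) \<le> dim (A \<inter> H')"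
    using assms by (intro dim_subset_fin_dim fin_dim_Int) auto
  then show ?thesis by (simp add: dim_mod_def)
qed

lemma dim_split:
  assumes "fin_dim A" "subspace H"
  shows "dim A = dim (A \<inter> H) + dim_mod A H"
  using dim_subset_fin_dim[of A "A \<inter> H"] assms by (simp add: dim_mod_def)

lemma dim_mod_pos:
  assumes A: "fin_dim A" and H: "subspace H" and "\<not> A \<subseteq> H"
  shows "1 \<le> dim_mod A H"
proof -
  obtain B where B: "B \<subseteq> A \<inter> H" "independent B" "span B = A \<inter> H" "finite B" "card B = dim (A \<inter> H)"
    using fin_dim_basis[OF fin_dim_Int[OF A H]] .
  obtain a where a: "a \<in> A" "a \<notin> span B" using assms(3) B by auto
  have "dim (insert a B) = Suc (card B)"
    using independent_insertI[OF a(2) B(2)] a(2) B by (metis card_insert_disjoint dim_eq_card_independent span_base)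
  moreover have "dim (insert a B) \<le> dim A" using B a by (intro dim_subset_fin_dim A) auto
  ultimately show ?thesis using B by (simp add: dim_mod_def)
qed

lemma dim_mod_subset: "A \<subseteq> H \<Longrightarrow> dim_mod A H = 0"
  by (simp add: dim_mod_def Int_absorb2)

text \<open>Adjoining \<open>Y\<close> to \<open>X\<close> enlarges the image modulo \<open>G\<close> by the part of \<open>Y\<close> that is new modulo \<open>X + G\<close>.\<close>

lemma dim_mod_span_Un:
  assumes X: "fin_dim X" and Y: "fin_dim Y" and G: "subspace G"
  shows "dim_mod X G + dim_mod Y (span (X \<union> G)) \<le> dim_mod (span (X \<union> Y)) G"
proof -
  define A where "A = span (X \<union> Y)"
  define K where "K = A \<inter> G"
  define Y' where "Y' = Y \<inter> span (X \<union> G)"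
  have A: "fin_dim A" and K: "fin_dim K" and Y': "fin_dim Y'"
    using X Y G by (auto simp: A_def K_def Y'_def intro: fin_dim_span_Un fin_dim_Int)
  have XK: "fin_dim (span (X \<union> K))" using X K by (rule fin_dim_span_Un)
  have "X \<inter> K = X \<inter> G" by (auto simp: K_def A_def span_base)
  then have 1: "dim (span (X \<union> K)) + dim (X \<inter> G) = dim X + dim K"
    using dim_span_Un[OF X K] by simp
  have "X \<subseteq> A" "Y \<subseteq> A" "K \<subseteq> A" by (auto simp: A_def K_def span_base)
  then have "span (span (X \<union> K) \<union> Y) \<subseteq> A"
    using fin_dim_subspace[OF A] by (intro span_minimal Un_least) auto
  then have "dim (span (span (X \<union> K) \<union> Y)) \<le> dim A"
    using A dim_subset_fin_dim by blast
  moreover have "dim (span (X \<union> K) \<inter> Y) \<le> dim Y'"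
    using span_mono[of "X \<union> K" "X \<union> G"] by (intro dim_subset_fin_dim Y') (auto simp: Y'_def K_def)
  moreover have "dim Y' \<le> dim Y" using Y by (intro dim_subset_fin_dim) (auto simp: Y'_def)
  ultimately have 2: "dim (span (X \<union> K)) + (dim Y - dim Y') \<le> dim A"
    using dim_span_Un[OF XK Y] by linarith
  have "dim (X \<inter> G) \<le> dim X" "dim K \<le> dim A"
    using X A by (auto simp: K_def intro: dim_subset_fin_dim)
  then show ?thesis using 1 2 unfolding dim_mod_def A_def[symmetric] K_def[symmetric] Y'_def[symmetric]
    by linarith
qed

end

sublocale domain_algebra \<subseteq> subspace_dimension scale ..

section \<open>Products of subspaces in a domain\<close>

context domain_algebra
begin

lemma linear_right_mult: "Vector_Spaces.linear scale scale (\<lambda>x. x * u)"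
  by unfold_locales (auto simp: algebra_simps scale_mult_left)

lemma right_mult_fin_dim:
  assumes "fin_dim A"
  shows "fin_dim ((\<lambda>x. x * u) ` A)"
proof -
  interpret rm: Vector_Spaces.linear scale scale "\<lambda>x. x * u" by (rule linear_right_mult)
  from assms obtain B where "finite B" "span B = A" by (auto simp: fin_dim_def)
  then show ?thesis using rm.span_image[of B] fin_dim_span[of "(\<lambda>x. x * u) ` B"] by simp
qed

lemma dim_right_mult:
  assumes "fin_dim A" "u \<noteq> 0"
  shows "dim ((\<lambda>x. x * u) ` A) = dim A"
proof -
  interpret rm: Vector_Spaces.linear scale scale "\<lambda>x. x * u" by (rule linear_right_mult)
  obtain B where B: "B \<subseteq> A" "independent B" "span B = A" "finite B" "card B = dim A"
    using fin_dim_basis[OF assms(1)] .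
  have inj: "inj_on (\<lambda>x. x * u) S" for S using assms(2) by (auto intro: inj_onI)
  have "independent ((\<lambda>x. x * u) ` B)" using rm.independent_injective_image[OF B(2) inj] .
  then have "dim (span ((\<lambda>x. x * u) ` B)) = card B"
    by (simp add: dim_eq_card_independent card_image[OF inj])
  then show ?thesis using rm.span_image[of B] B by simp
qed

lemma span_prod_mem: "v \<in> V \<Longrightarrow> w \<in> W \<Longrightarrow> v * w \<in> span_prod V W"
  by (auto simp: span_prod_def intro: span_base)

lemma span_prod_le: "(\<And>v w. v \<in> V \<Longrightarrow> w \<in> W \<Longrightarrow> v * w \<in> S) \<Longrightarrow> subspace S \<Longrightarrow> span_prod V W \<subseteq> S"
  unfolding span_prod_def by (rule span_minimal) auto

lemma span_prod_mono: "V \<subseteq> V' \<Longrightarrow> W \<subseteq> W' \<Longrightarrow> span_prod V W \<subseteq> span_prod V' W'"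
  unfolding span_prod_def by (rule span_mono) auto

lemma subspace_left_mult_preimage: "subspace S \<Longrightarrow> subspace {y. x * y \<in> S}"
  by (auto simp: subspace_def scale_mult_right algebra_simps)

lemma subspace_right_mult_preimage: "subspace S \<Longrightarrow> subspace {x. x * y \<in> S}"
  by (auto simp: subspace_def scale_mult_left algebra_simps)

lemma fin_dim_span_prod:
  assumes "fin_dim V" "fin_dim W"
  shows "fin_dim (span_prod V W)"
proof -
  obtain A B where AB: "finite A" "span A = V" "finite B" "span B = W"
    using assms by (auto simp: fin_dim_def)
  define P where "P = (\<lambda>(a, b). a * b) ` (A \<times> B)"
  have P: "a * b \<in> span P" if "a \<in> A" "b \<in> B" for a b
    using that by (force simp: P_def intro: span_base)
  have "A \<subseteq> {v. v * b \<in> span P}" if "b \<in> B" for b using P that by auto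
  then have 1: "V \<subseteq> {v. v * b \<in> span P}" if "b \<in> B" for b
    using that AB span_minimal subspace_right_mult_preimage subspace_span by metis
  then have "B \<subseteq> {w. v * w \<in> span P}" if "v \<in> V" for v using that by auto
  then have "W \<subseteq> {w. v * w \<in> span P}" if "v \<in> V" for v
    using that AB span_minimal subspace_left_mult_preimage subspace_span by metis
  then have "span_prod V W \<subseteq> span P" by (intro span_prod_le) auto
  moreover have "fin_dim (span P)" using AB by (auto simp: P_def intro: fin_dim_span)
  ultimately show ?thesis
    using fin_dim_subset[of "span P"] by (auto simp: span_prod_def)
qed

end

section \<open>Left submodules over a division subalgebra, and thick subspaces\<close>

locale division_extension = division_algebra scale
  for scale :: "'k::field \<Rightarrow> 'd::division_ring \<Rightarrow> 'd" (infixr "*k" 75) +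
  fixes E :: "'d set"
  assumes division_subalgebra_E: "division_subalgebra E"
begin

definition left_submodule :: "'d set \<Rightarrow> bool" where
  "left_submodule F \<longleftrightarrow> 0 \<in> F \<and> (\<forall>x\<in>F. \<forall>y\<in>F. x + y \<in> F) \<and> (\<forall>e\<in>E. \<forall>x\<in>F. e * x \<in> F)"

definition left_hull :: "'d set \<Rightarrow> 'd set" where
  "left_hull S = left_submodule hull S"

text \<open>Every nonzero image of \<open>Z\<close> in a quotient of \<open>D\<close> by a left \<open>E\<close>-submodule has dimension at least \<open>t\<close>.
  Hyperplanes of the \<open>E\<close>-span of \<open>Z\<close> are the smallest such quotients, so a \<open>t\<close>-thick subspace has
  length at least \<open>t\<close> in every direction over \<open>E\<close>.\<close>

definition thick :: "nat \<Rightarrow> 'd set \<Rightarrow> bool" where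
  "thick t Z \<longleftrightarrow> (\<forall>H. left_submodule H \<longrightarrow> \<not> Z \<subseteq> H \<longrightarrow> t \<le> dim_mod Z H)"

lemma subspace_E: "subspace E" and one_E: "1 \<in> E"
  and mult_E: "x \<in> E \<Longrightarrow> y \<in> E \<Longrightarrow> x * y \<in> E" and inverse_E: "x \<in> E \<Longrightarrow> inverse x \<in> E"
  using division_subalgebra_E by (auto simp: division_subalgebra_def)

lemma left_submodule_subspace:
  assumes "left_submodule F"
  shows "subspace F"
proof (rule subspaceI)
  fix c x assume "x \<in> F"
  moreover have "(c *k 1) \<in> E" using subspace_E one_E subspace_scale by blast
  ultimately have "(c *k 1) * x \<in> F" using assms by (auto simp: left_submodule_def)
  then show "c *k x \<in> F" by (simp add: scale_mult_left)
qed (use assms in \<open>auto simp: left_submodule_def\<close>)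

lemma left_submodule_mult: "left_submodule F \<Longrightarrow> e \<in> E \<Longrightarrow> x \<in> F \<Longrightarrow> e * x \<in> F"
  by (auto simp: left_submodule_def)

lemma left_submodule_UNIV: "left_submodule UNIV" and left_submodule_0: "left_submodule {0}"
  by (auto simp: left_submodule_def)

lemma left_submodule_hull: "left_submodule (left_hull S)"
  unfolding left_hull_def by (rule hull_in) (auto simp: left_submodule_def)

lemma left_hull_superset: "S \<subseteq> left_hull S"
  unfolding left_hull_def by (rule hull_subset)

lemma left_hull_minimal: "S \<subseteq> F \<Longrightarrow> left_submodule F \<Longrightarrow> left_hull S \<subseteq> F"
  unfolding left_hull_def by (rule hull_minimal)

lemma left_submodule_right_mult_preimage: "left_submodule F \<Longrightarrow> left_submodule {x. x * u \<in> F}"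
  by (auto simp: left_submodule_def algebra_simps)

lemma left_submodule_Int: "left_submodule F \<Longrightarrow> left_submodule G \<Longrightarrow> left_submodule (F \<inter> G)"
  by (auto simp: left_submodule_def)

lemma thick_right_mult:
  assumes Z: "fin_dim Z" "thick t Z" and u: "u \<noteq> 0"
  shows "thick t ((\<lambda>x. x * u) ` Z)"
  unfolding thick_def
proof (intro allI impI)
  fix H assume H: "left_submodule H" "\<not> (\<lambda>x. x * u) ` Z \<subseteq> H"
  define H' where "H' = {x. x * u \<in> H}"
  have H': "left_submodule H'" "\<not> Z \<subseteq> H'" using H left_submodule_right_mult_preimage by (auto simp: H'_def)
  have "(\<lambda>x. x * u) ` Z \<inter> H = (\<lambda>x. x * u) ` (Z \<inter> H')" by (auto simp: H'_def)
  then have "dim_mod ((\<lambda>x. x * u) ` Z) H = dim_mod Z H'"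
    using dim_right_mult[OF _ u] Z fin_dim_Int left_submodule_subspace[OF H'(1)] by (simp add: dim_mod_def)
  then show "t \<le> dim_mod ((\<lambda>x. x * u) ` Z) H"
    using Z H' by (auto simp: thick_def)
qed

text \<open>The gain in one layer.  \<open>X\<close> is the part of \<open>W\<close> already there, thin modulo \<open>G\<close>, and \<open>Y\<close> is a thick
  newcomer.  Let \<open>Y'\<close> be the part of \<open>Y\<close> that is not new.  If \<open>Y'\<close> spans a smaller submodule than \<open>Y\<close>
  over \<open>E\<close>, modulo \<open>G\<close>, thickness of \<open>Y\<close> leaves at least \<open>s\<close> new dimensions.  Otherwise \<open>Y'\<close> agrees
  modulo \<open>G\<close> with a subspace \<open>X'\<close> of \<open>X\<close>, which has a nonzero quotient of dimension at most \<open>m\<close>; the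
  same quotient of \<open>Y\<close> has dimension at least \<open>s\<close>, so at least \<open>s - m\<close> dimensions of \<open>Y\<close> are new.\<close>

lemma dim_mod_layer:
  assumes X: "fin_dim X" and Y: "fin_dim Y" and G: "left_submodule G"
    and thick: "thick s Y" "\<not> Y \<subseteq> G"
    and thin: "\<And>X'. subspace X' \<Longrightarrow> X' \<subseteq> X \<Longrightarrow> \<not> X' \<subseteq> G \<Longrightarrow>
      \<exists>H. left_submodule H \<and> G \<subseteq> H \<and> \<not> X' \<subseteq> H \<and> dim_mod X' H \<le> m"
  shows "dim_mod X G + (s - m) \<le> dim_mod (span (X \<union> Y)) G"
proof -
  have sub: "subspace X" "subspace Y" "subspace G" using X Y G fin_dim_subspace left_submodule_subspace by auto
  define Y' where "Y' = Y \<inter> span (X \<union> G)"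
  have Y': "fin_dim Y'" "subspace Y'" using Y by (auto simp: Y'_def intro: fin_dim_Int fin_dim_subspace)
  have le: "dim Y' \<le> dim Y" using Y by (auto simp: Y'_def intro: dim_subset_fin_dim)
  have "s - m \<le> dim_mod Y (span (X \<union> G))"
  proof (cases "Y \<subseteq> left_hull (Y' \<union> G)")
    case False
    then have "s \<le> dim_mod Y (left_hull (Y' \<union> G))" using thick left_submodule_hull by (auto simp: thick_def)
    moreover have "dim Y' \<le> dim (Y \<inter> left_hull (Y' \<union> G))"
      using left_hull_superset[of "Y' \<union> G"] left_submodule_subspace[OF left_submodule_hull]
      by (intro dim_subset_fin_dim fin_dim_Int Y) (auto simp: Y'_def)
    ultimately show ?thesis by (simp add: dim_mod_def Y'_def)
  next
    case True
    define X' where "X' = X \<inter> span (Y' \<union> G)"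
    have X': "subspace X'" "X' \<subseteq> X" using sub by (auto simp: X'_def intro: subspace_inter)
    have 1: "\<exists>x\<in>X'. y - x \<in> G" if y: "y \<in> Y'" for y
    proof -
      obtain x g where x: "x \<in> X" "g \<in> G" "y = x + g"
        using y sub by (auto simp: Y'_def span_Un_mem)
      then have "x = y + (- g)" "- g \<in> G" using sub subspace_neg by auto
      then have "x \<in> X'" using x y unfolding X'_def Int_iff span_Un_mem[OF Y'(2) sub(3)] by blast
      then show ?thesis using x by force
    qed
    have 2: "\<exists>y\<in>Y'. x - y \<in> G" if "x \<in> X'" for x
      using that unfolding X'_def Int_iff span_Un_mem[OF Y'(2) sub(3)] by force
    have "\<not> Y' \<subseteq> G"
    proof
      assume "Y' \<subseteq> G"
      then have "left_hull (Y' \<union> G) \<subseteq> G" using G by (intro left_hull_minimal) auto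
      then show False using True thick by auto
    qed
    then have "\<not> X' \<subseteq> G" using 1 sub(3) subspace_add[of G] by (metis diff_add_cancel subset_iff)
    then obtain H where H: "left_submodule H" "G \<subseteq> H" "\<not> X' \<subseteq> H" "dim_mod X' H \<le> m"
      using thin X' by blast
    have X'f: "fin_dim X'" using X X' fin_dim_subset by auto
    have sH: "subspace H" using H left_submodule_subspace by auto
    have "dim_mod Y' H \<le> dim_mod X' H"
      using 1 H by (intro dim_mod_le Y' X'f sH) blast
    moreover have "\<not> Y' \<subseteq> H" using 2 H sH subspace_add[of H] by (metis diff_add_cancel subset_iff)
    then have "s \<le> dim_mod Y H" using thick H by (auto simp: thick_def Y'_def)
    moreover have "dim (Y' \<inter> H) \<le> dim (Y \<inter> H)"
      using Y sH by (intro dim_subset_fin_dim fin_dim_Int) (auto simp: Y'_def)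
    ultimately have "s - m \<le> dim Y - dim Y'" using H(4) le unfolding dim_mod_def by linarith
    then show ?thesis by (simp add: dim_mod_def Y'_def)
  qed
  then show ?thesis using dim_mod_span_Un[OF X Y sub(3)] by linarith
qed

section \<open>Growth under right multiplication\<close>

text \<open>
  Sums of \<open>t\<close>-thick subspaces are \<open>t\<close>-thick, so for \<open>t > 0\<close> the intersection of \<open>W\<close> with the radical
  is the largest \<open>t\<close>-thick subspace of \<open>W\<close>.  The radicals decrease with \<open>t\<close> and cut \<open>D\<close> into layers.
  Every finite-dimensional subspace is both \<open>0\<close>-thick and \<open>1\<close>-thick, so the general formula would repeat the \<open>E\<close>-span of
  \<open>W\<close> at \<open>t = 0\<close>; with the value \<open>UNIV\<close> instead, the bottom layer is the part of \<open>D\<close> outside of this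
  span, which \<open>W\<close> does not meet.
\<close>

definition thick_radical :: "'d set \<Rightarrow> nat \<Rightarrow> 'd set" where
  "thick_radical W t = (if t = 0 then UNIV else left_hull (\<Union>{Z. subspace Z \<and> Z \<subseteq> W \<and> thick t Z}))"

lemma left_submodule_thick_radical: "left_submodule (thick_radical W t)"
  by (simp add: thick_radical_def left_submodule_UNIV left_submodule_hull)

lemma subspace_thick_radical: "subspace (thick_radical W t)"
  by (rule left_submodule_subspace[OF left_submodule_thick_radical])

lemma thick_subset_thick_radical: "subspace Z \<Longrightarrow> Z \<subseteq> W \<Longrightarrow> thick t Z \<Longrightarrow> Z \<subseteq> thick_radical W t"
  using left_hull_superset unfolding thick_radical_def by fastforce

lemma thick_mono: "thick t Z \<Longrightarrow> s \<le> t \<Longrightarrow> thick s Z"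
  using le_trans unfolding thick_def by blast

lemma thick_radical_anti: "s \<le> t \<Longrightarrow> thick_radical W t \<subseteq> thick_radical W s"
proof -
  assume "s \<le> t"
  then have "\<Union>{Z. subspace Z \<and> Z \<subseteq> W \<and> thick t Z} \<subseteq> \<Union>{Z. subspace Z \<and> Z \<subseteq> W \<and> thick s Z}"
    using thick_mono by blast
  then show ?thesis using \<open>s \<le> t\<close> by (simp add: thick_radical_def left_hull_def hull_mono)
qed

lemma thick_radical_le:
  assumes "0 < t" "left_submodule H" "W \<inter> thick_radical W t \<subseteq> H"
  shows "thick_radical W t \<subseteq> H"
proof -
  have "\<Union>{Z. subspace Z \<and> Z \<subseteq> W \<and> thick t Z} \<subseteq> H"
    using thick_subset_thick_radical[of _ W t] assms by blast
  then show ?thesis using assms left_hull_minimal by (simp add: thick_radical_def)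
qed

lemma thick_Int_thick_radical:
  assumes W: "fin_dim W"
  shows "thick t (W \<inter> thick_radical W t)"
proof (cases "t = 0")
  case False
  show ?thesis unfolding thick_def
  proof (intro allI impI)
    fix H assume H: "left_submodule H" "\<not> W \<inter> thick_radical W t \<subseteq> H"
    then have "\<not> left_hull (\<Union>{Z. subspace Z \<and> Z \<subseteq> W \<and> thick t Z}) \<subseteq> H" using False by (auto simp: thick_radical_def)
    then have "\<not> \<Union>{Z. subspace Z \<and> Z \<subseteq> W \<and> thick t Z} \<subseteq> H" using H(1) left_hull_minimal by blast
    then obtain Z where Z: "subspace Z" "Z \<subseteq> W" "thick t Z" "\<not> Z \<subseteq> H" by blast
    then have "t \<le> dim_mod Z H" using H by (auto simp: thick_def)
    also have "\<dots> \<le> dim_mod (W \<inter> thick_radical W t) H"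
      using Z W thick_subset_thick_radical H(1)
      by (intro dim_mod_mono fin_dim_Int subspace_thick_radical left_submodule_subspace) (auto intro: fin_dim_subset)
    finally show "t \<le> dim_mod (W \<inter> thick_radical W t) H" .
  qed
qed (simp add: thick_def)

text \<open>The layer between consecutive radicals is thin: a subspace of \<open>W\<close> not contained in the radical of
  thickness \<open>m + 1\<close>, enlarged by the \<open>(m + 1)\<close>-thick part of \<open>W\<close>, is no longer \<open>(m + 1)\<close>-thick.  A small
  quotient that shows this has to kill the \<open>(m + 1)\<close>-thick part, hence the whole radical.\<close>

lemma thick_radical_thin:
  assumes W: "fin_dim W" and X': "subspace X'" "X' \<subseteq> W \<inter> thick_radical W m" "\<not> X' \<subseteq> thick_radical W (Suc m)"
  shows "\<exists>H. left_submodule H \<and> thick_radical W (Suc m) \<subseteq> H \<and> \<not> X' \<subseteq> H \<and> dim_mod X' H \<le> m"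
proof -
  let ?G = "thick_radical W (Suc m)"
  define X where "X = span (X' \<union> (W \<inter> ?G))"
  have sub: "subspace (W \<inter> ?G)" using W subspace_thick_radical fin_dim_subspace subspace_inter by blast
  have "X \<subseteq> W" unfolding X_def using X' W fin_dim_subspace by (intro span_minimal) auto
  have "X' \<subseteq> X" using span_superset[of "X' \<union> (W \<inter> ?G)"] by (simp add: X_def)
  then have "\<not> X \<subseteq> ?G" using X'(3) by blast
  with \<open>X \<subseteq> W\<close> have "\<not> thick (Suc m) X" using thick_subset_thick_radical[of X] by (auto simp: X_def)
  then obtain H where H: "left_submodule H" "\<not> X \<subseteq> H" "dim_mod X H \<le> m"
    unfolding thick_def by (metis not_less_eq_eq)
  have Xf: "fin_dim X" using \<open>X \<subseteq> W\<close> W fin_dim_subset by (auto simp: X_def)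
  have WG: "W \<inter> ?G \<subseteq> H"
  proof (rule ccontr)
    assume "\<not> W \<inter> ?G \<subseteq> H"
    then have "Suc m \<le> dim_mod (W \<inter> ?G) H" using thick_Int_thick_radical[OF W] H by (auto simp: thick_def)
    also have "\<dots> \<le> dim_mod X H"
      using W Xf H by (intro dim_mod_mono fin_dim_Int subspace_thick_radical left_submodule_subspace) (auto simp: X_def span_base)
    finally show False using H by simp
  qed
  then have G: "?G \<subseteq> H" using thick_radical_le H by blast
  have "\<not> X' \<subseteq> H"
  proof
    assume "X' \<subseteq> H"
    then have "X \<subseteq> H" unfolding X_def using WG H left_submodule_subspace by (intro span_minimal) auto
    then show False using H by simp
  qed
  moreover have "dim_mod X' H \<le> dim_mod X H"
    using H X' W Xf by (intro dim_mod_mono left_submodule_subspace) (auto simp: X_def span_base intro: fin_dim_subset)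
  ultimately show ?thesis using H G by auto
qed

text \<open>It suffices to test the generators \<open>Z\<close> of a submodule: if \<open>Z u\<close> stays inside, so does the whole
  translate by \<open>u\<close>.\<close>

definition moves_submodules :: "'d set \<Rightarrow> bool" where
  "moves_submodules U \<longleftrightarrow>
     (\<forall>Z. fin_dim Z \<longrightarrow> Z \<noteq> {0} \<longrightarrow> (\<exists>u\<in>U. \<not> (\<lambda>x. x * u) ` Z \<subseteq> left_hull Z))"

text \<open>Induction over the layers.  Let \<open>Z\<close> be the \<open>s\<close>-thick part of \<open>W\<close> and \<open>m < s\<close> the largest thickness whose
  radical still contains \<open>Z U\<close>.  Modulo the radical of thickness \<open>m\<close> the growth is at least \<open>m\<close> by
  induction; some translate \<open>Z u\<close> leaves the next radical and is \<open>s\<close>-thick, so the layer between the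
  two contributes at least \<open>s - m\<close> more.\<close>

lemma growth_mod_thick_radical:
  assumes W: "fin_dim W" and U: "fin_dim U" "1 \<in> U" "moves_submodules U"
    and "W \<inter> thick_radical W s \<noteq> {0}"
  shows "dim_mod W (thick_radical W s) + s \<le> dim_mod (span_prod W U) (thick_radical W s)"
  using assms(5)
proof (induction s rule: less_induct)
  case (less s)
  let ?R = "span_prod W U"
  have R: "fin_dim ?R" using W U by (intro fin_dim_span_prod)
  have WR: "W \<subseteq> ?R"
    using span_prod_mem[of _ W 1 U] U by auto
  show ?case
  proof (cases "s = 0")
    case True
    then show ?thesis by (simp add: dim_mod_subset thick_radical_def)
  next
    case False
    define Z where "Z = W \<inter> thick_radical W s"
    have Z: "fin_dim Z" using W subspace_thick_radical by (auto simp: Z_def intro: fin_dim_Int)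
    \<comment> \<open>The value \<open>UNIV\<close> of the radical at \<open>0\<close> guarantees that \<open>m\<close> exists.\<close>
    define M where "M = {r. r < s \<and> (\<forall>u\<in>U. (\<lambda>x. x * u) ` Z \<subseteq> thick_radical W r)}"
    define m where "m = Max M"
    have M: "finite M" "0 \<in> M" using False by (auto simp: M_def thick_radical_def)
    then have m: "m \<in> M" unfolding m_def by (intro Max_in) auto
    then have ms: "m < s" by (simp add: M_def)
    let ?F = "thick_radical W m" and ?G = "thick_radical W (Suc m)"
    have GF: "?G \<subseteq> ?F" "thick_radical W s \<subseteq> ?G" using ms by (simp_all add: thick_radical_anti)
    have "\<exists>u\<in>U. \<not> (\<lambda>x. x * u) ` Z \<subseteq> ?G"
    proof (cases "Suc m = s")
      case True
      have "left_hull Z = thick_radical W s"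
        using False thick_radical_le[of s "left_hull Z" W] left_hull_superset[of Z] left_hull_minimal[of Z "thick_radical W s"] left_submodule_hull left_submodule_thick_radical
        by (auto simp: Z_def)
      moreover have "Z \<noteq> {0}" using less.prems by (simp add: Z_def)
      ultimately show ?thesis using U(3)[unfolded moves_submodules_def, rule_format, OF Z] True by simp
    next
      case False
      then have "Suc m \<notin> M" using Max_ge[OF M(1), of "Suc m"] by (auto simp: m_def)
      then show ?thesis using False ms by (auto simp: M_def)
    qed
    then obtain u where u: "u \<in> U" "\<not> (\<lambda>x. x * u) ` Z \<subseteq> ?G" by blast
    define X where "X = W \<inter> ?F"
    define Y where "Y = (\<lambda>x. x * u) ` Z"
    have X: "fin_dim X" and Y: "fin_dim Y" using W Z subspace_thick_radical
      by (auto simp: X_def Y_def intro: fin_dim_Int right_mult_fin_dim)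
    have "u \<noteq> 0" using u subspace_thick_radical subspace_0 by auto
    then have "thick s Y" using Z W thick_Int_thick_radical by (auto simp: Y_def Z_def intro!: thick_right_mult)
    then have layer: "dim_mod X ?G + (s - m) \<le> dim_mod (span (X \<union> Y)) ?G"
      using X Y u ms thick_radical_thin[OF W] by (intro dim_mod_layer left_submodule_thick_radical) (auto simp: Y_def X_def)
    have "X \<union> Y \<subseteq> ?R \<inter> ?F"
      using WR m u span_prod_mem[of _ W u U] by (auto simp: X_def Y_def Z_def M_def)
    moreover have RF: "fin_dim (?R \<inter> ?F)" using R subspace_thick_radical by (rule fin_dim_Int)
    ultimately have "span (X \<union> Y) \<subseteq> ?R \<inter> ?F" using fin_dim_subspace by (intro span_minimal) auto
    then have "dim_mod (span (X \<union> Y)) ?G \<le> dim_mod (?R \<inter> ?F) ?G"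
      using RF X Y by (intro dim_mod_mono fin_dim_span_Un subspace_thick_radical)
    with layer have "dim_mod X ?G + (s - m) \<le> dim_mod (?R \<inter> ?F) ?G" by simp
    moreover have "X \<inter> ?G = W \<inter> ?G" "?R \<inter> ?F \<inter> ?G = ?R \<inter> ?G" using GF by (auto simp: X_def)
    ultimately have 1: "(dim (W \<inter> ?F) - dim (W \<inter> ?G)) + (s - m) \<le> dim (?R \<inter> ?F) - dim (?R \<inter> ?G)"
      by (simp add: dim_mod_def X_def)
    have "Z \<subseteq> X" using GF by (auto simp: Z_def X_def)
    moreover have "0 \<in> Z" using Z fin_dim_subspace subspace_0 by auto
    ultimately have "W \<inter> ?F \<noteq> {0}" using less.prems by (auto simp: X_def Z_def)
    then have 2: "(dim W - dim (W \<inter> ?F)) + m \<le> dim ?R - dim (?R \<inter> ?F)"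
      using less.IH[OF ms] by (simp add: dim_mod_def)
    have "dim_mod (W \<inter> ?G) (thick_radical W s) \<le> dim_mod (?R \<inter> ?G) (thick_radical W s)"
      using W R WR by (intro dim_mod_mono fin_dim_Int subspace_thick_radical) auto
    moreover have "W \<inter> ?G \<inter> thick_radical W s = W \<inter> thick_radical W s" "?R \<inter> ?G \<inter> thick_radical W s = ?R \<inter> thick_radical W s"
      using GF by auto
    ultimately have 3: "dim (W \<inter> ?G) - dim (W \<inter> thick_radical W s) \<le> dim (?R \<inter> ?G) - dim (?R \<inter> thick_radical W s)"
      by (simp add: dim_mod_def)
    \<comment> \<open>\<open>1\<close>, \<open>2\<close> and \<open>3\<close> are the gains between the radicals of thickness \<open>m\<close> and \<open>m + 1\<close>, above the
      former, and below the latter; they telescope.\<close>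
    have chain: "dim (A \<inter> thick_radical W s) \<le> dim (A \<inter> ?G)" "dim (A \<inter> ?G) \<le> dim (A \<inter> ?F)" "dim (A \<inter> ?F) \<le> dim A"
      if "fin_dim A" for A
      using that GF subspace_thick_radical by (auto intro!: dim_subset_fin_dim fin_dim_Int)
    show ?thesis
      using 1 2 3 chain[OF W] chain[OF R] ms unfolding dim_mod_def by linarith
  qed
qed

lemma growth_right:
  assumes W: "fin_dim W" and U: "fin_dim U" "1 \<in> U" "moves_submodules U"
    and Z: "subspace Z" "Z \<subseteq> W" "Z \<noteq> {0}" "thick t Z"
  shows "dim W + t \<le> dim (span_prod W U)"
proof -
  let ?R = "span_prod W U"
  have R: "fin_dim ?R" using W U by (intro fin_dim_span_prod)
  have "W \<subseteq> ?R" using span_prod_mem[of _ W 1 U] U by auto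
  then have "dim (W \<inter> thick_radical W t) \<le> dim (?R \<inter> thick_radical W t)"
    using R subspace_thick_radical by (intro dim_subset_fin_dim fin_dim_Int) auto
  moreover have "Z \<subseteq> W \<inter> thick_radical W t" using thick_subset_thick_radical Z by auto
  then have "W \<inter> thick_radical W t \<noteq> {0}" using Z subspace_0 by auto
  then have "dim_mod W (thick_radical W t) + t \<le> dim_mod ?R (thick_radical W t)"
    using growth_mod_thick_radical W U by auto
  ultimately show ?thesis
    using dim_split[OF W subspace_thick_radical, of W t] dim_split[OF R subspace_thick_radical, of W t] by linarith
qed

section \<open>A subframe that moves every finitely generated submodule\<close>

lemma left_submodule_diff: "left_submodule F \<Longrightarrow> x \<in> F \<Longrightarrow> y \<in> F \<Longrightarrow> x - y \<in> F"
  using left_submodule_subspace subspace_diff by blast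

lemma left_submodule_add: "left_submodule F \<Longrightarrow> x \<in> F \<Longrightarrow> y \<in> F \<Longrightarrow> x + y \<in> F"
  by (auto simp: left_submodule_def)

lemma left_hull_insert_mem:
  assumes F: "left_submodule F" and x: "x \<in> left_hull (insert w F)"
  shows "\<exists>e\<in>E. x - e * w \<in> F"
proof -
  let ?T = "{x. \<exists>e\<in>E. x - e * w \<in> F}"
  have "left_submodule ?T"
    unfolding left_submodule_def
  proof (intro conjI ballI; clarsimp)
    show "\<exists>e\<in>E. - (e * w) \<in> F" using F subspace_0[OF subspace_E] by (intro bexI[of _ 0]) (auto simp: left_submodule_def)
  next
    fix x y e e' assume *: "e \<in> E" "x - e * w \<in> F" "e' \<in> E" "y - e' * w \<in> F"
    then have "x + y - (e + e') * w \<in> F" using left_submodule_add[OF F *(2,4)] by (simp add: algebra_simps)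
    then show "\<exists>e\<in>E. x + y - e * w \<in> F" using * subspace_add[OF subspace_E] by blast
  next
    fix e x e' assume *: "e \<in> E" "e' \<in> E" "x - e' * w \<in> F"
    then have "e * x - (e * e') * w \<in> F" using left_submodule_mult[OF F *(1,3)] by (simp add: algebra_simps)
    then show "\<exists>a\<in>E. e * x - a * w \<in> F" using * mult_E by blast
  qed
  moreover have "insert w F \<subseteq> ?T"
  proof (intro insert_subsetI subsetI CollectI)
    show "\<exists>e\<in>E. w - e * w \<in> F" using F one_E by (intro bexI[of _ 1]) (auto simp: left_submodule_def)
    show "\<exists>e\<in>E. x - e * w \<in> F" if "x \<in> F" for x
      using that subspace_0[OF subspace_E] by (intro bexI[of _ 0]) auto
  qed
  ultimately have "left_hull (insert w F) \<subseteq> ?T" by (rule left_hull_minimal[rotated])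
  then show ?thesis using x by blast
qed

lemma left_hull_insert: "left_hull (insert w (left_hull B)) = left_hull (insert w B)"
  unfolding left_hull_def by (rule hull_insert[symmetric])

lemma left_hull_empty: "left_hull {} = {0}"
  using left_hull_minimal[OF _ left_submodule_0, of "{}"] left_submodule_hull[of "{}"] by (auto simp: left_submodule_def)

lemma left_hull_left_submodule: "left_submodule F \<Longrightarrow> left_hull F = F"
  unfolding left_hull_def by (rule hull_same)

lemma left_hull_mono: "A \<subseteq> B \<Longrightarrow> left_hull A \<subseteq> left_hull B"
  unfolding left_hull_def by (rule hull_mono)

text \<open>This replaces dimension theory over the skew field \<open>E\<close>: the least number of generators is monotone
  on submodules, strictly so on proper ones.\<close>

lemma left_submodule_generators:
  assumes "finite B" "left_submodule G" "G \<subseteq> left_hull B"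
  shows "\<exists>C. finite C \<and> left_hull C = G \<and> card C \<le> card B \<and> (G \<noteq> left_hull B \<longrightarrow> card C < card B)"
  using assms
proof (induction B arbitrary: G rule: finite_induct)
  case empty
  then have "G = {0}" using left_hull_empty by (auto simp: left_submodule_def)
  then show ?case using left_hull_empty by (intro exI[of _ "{}"]) auto
next
  case (insert w B)
  let ?F = "left_hull B"
  have F: "left_submodule ?F" by (rule left_submodule_hull)
  show ?case
  proof (cases "G \<subseteq> ?F")
    case True
    then show ?thesis using insert.IH[OF insert.prems(1) True] insert.hyps by (metis card_insert_disjoint le_Suc_eq less_Suc_eq_le)
  next
    case False
    then obtain g where g: "g \<in> G" "g \<notin> ?F" by blast
    then obtain e where e: "e \<in> E" "g - e * w \<in> ?F"
      using left_hull_insert_mem[OF F, of g w] insert.prems(2) unfolding left_hull_insert by blast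
    have "e \<noteq> 0" using e g by auto
    \<comment> \<open>An element of \<open>G\<close> with leading coefficient \<open>1\<close> at \<open>w\<close>; together with generators of the
      intersection of \<open>G\<close> with \<open>?F\<close> it generates \<open>G\<close>.\<close>
    define h where "h = inverse e * g"
    have "h - w = inverse e * (g - e * w)" using \<open>e \<noteq> 0\<close>
      by (simp add: h_def right_diff_distrib flip: mult.assoc)
    then have hw: "h - w \<in> ?F" using e left_submodule_mult[OF F inverse_E] by simp
    have h: "h \<in> G" using g e inverse_E insert.prems left_submodule_mult by (auto simp: h_def)
    have "left_submodule (G \<inter> ?F)" using insert.prems F left_submodule_Int by blast
    then obtain C where C: "finite C" "left_hull C = G \<inter> ?F" "card C \<le> card B" "G \<inter> ?F \<noteq> ?F \<longrightarrow> card C < card B"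
      using insert.IH[of "G \<inter> ?F"] by auto
    have "left_hull (insert h C) \<subseteq> G"
      using h C left_hull_superset[of C] insert.prems by (intro left_hull_minimal) auto
    moreover have "x \<in> left_hull (insert h C)" if x: "x \<in> G" for x
    proof -
      obtain a where a: "a \<in> E" "x - a * w \<in> ?F"
        using left_hull_insert_mem[OF F, of x w] insert.prems(2) x unfolding left_hull_insert by blast
      have "x - a * h = (x - a * w) - a * (h - w)" by (simp add: algebra_simps)
      then have "x - a * h \<in> ?F" using left_submodule_diff[OF F a(2) left_submodule_mult[OF F a(1) hw]] by (simp only:)
      moreover have "x - a * h \<in> G" using x h a insert.prems(1) by (intro left_submodule_diff left_submodule_mult)
      ultimately have "x - a * h \<in> left_hull (insert h C)" using C left_hull_mono[of C "insert h C"] by auto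
      moreover have "a * h \<in> left_hull (insert h C)"
        using left_hull_superset[of "insert h C"] a by (intro left_submodule_mult left_submodule_hull) auto
      ultimately have "(x - a * h) + a * h \<in> left_hull (insert h C)" by (rule left_submodule_add[OF left_submodule_hull])
      then show ?thesis by simp
    qed
    ultimately have gen: "left_hull (insert h C) = G" by (intro equalityI subsetI) auto
    have full: "G = left_hull (insert w B)" if F_G: "G \<inter> ?F = ?F"
    proof -
      have FG: "?F \<subseteq> G" using F_G by (rule inf.absorb_iff2[THEN iffD2])
      then have "h - (h - w) \<in> G" by (intro left_submodule_diff[OF insert.prems(1) h subsetD[OF _ hw]])
      then have "w \<in> G" by simp
      then have "insert w B \<subseteq> G" using FG left_hull_superset[of B] by blast
      then have "left_hull (insert w B) \<subseteq> G" using insert.prems(1) by (rule left_hull_minimal)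
      with insert.prems(2) show ?thesis by (rule equalityI)
    qed
    have card: "card (insert h C) \<le> Suc (card C)" "card (insert w B) = Suc (card B)"
      using C(1) insert.hyps by (simp_all add: card_insert_if)
    show ?thesis
    proof (intro exI[of _ "insert h C"] conjI impI)
      show "card (insert h C) < card (insert w B)" if "G \<noteq> left_hull (insert w B)"
        using C(4) full that card by linarith
    qed (use C(1,3) gen card in simp_all)
  qed
qed

text \<open>An injective endomorphism of a finite-dimensional space is surjective.  Here \<open>F\<close> is the span of \<open>B\<close>,
  and \<open>G = F x\<close>; generators of \<open>G\<close> are carried by \<open>inverse x\<close> to as many generators of \<open>F\<close>, so \<open>G\<close>
  cannot be a proper submodule of \<open>F\<close>.\<close>

lemma right_mult_inverse_closed:
  assumes B: "finite B" and x: "x \<noteq> 0" and le: "\<And>f. f \<in> left_hull B \<Longrightarrow> f * x \<in> left_hull B"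
    and f: "f \<in> left_hull B"
  shows "f * inverse x \<in> left_hull B"
proof -
  let ?F = "left_hull B"
  let ?P = "\<lambda>n. \<exists>C. finite C \<and> left_hull C = ?F \<and> card C = n"
  define n where "n = (LEAST n. ?P n)"
  have "?P (card B)" using B by (intro exI[of _ B]) simp
  then have "?P n" unfolding n_def by (rule LeastI[of ?P])
  then obtain C where "finite C \<and> left_hull C = ?F \<and> card C = n" ..
  then have C: "finite C" "left_hull C = ?F" "card C = n" by simp_all
  define G where "G = {y. y * inverse x \<in> ?F}"
  have G: "left_submodule G" unfolding G_def by (rule left_submodule_right_mult_preimage[OF left_submodule_hull])
  have GF: "G \<subseteq> ?F"
  proof
    fix y assume "y \<in> G"
    then have "(y * inverse x) * x \<in> ?F" unfolding G_def by (intro le) simp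
    then show "y \<in> ?F" using x by (simp add: mult.assoc)
  qed
  have "G = ?F"
  proof (rule ccontr)
    assume neq: "G \<noteq> ?F"
    have "G \<subseteq> left_hull C" using GF C(2) by simp
    from left_submodule_generators[OF C(1) G this] obtain C'
      where "finite C' \<and> left_hull C' = G \<and> card C' \<le> card C \<and> (G \<noteq> left_hull C \<longrightarrow> card C' < card C)" ..
    then have C': "finite C'" "left_hull C' = G" "card C' < n" using neq C(2,3) by simp_all
    define D where "D = (\<lambda>y. y * inverse x) ` C'"
    have D: "finite D" using C'(1) by (simp add: D_def)
    have "C' \<subseteq> G" unfolding C'(2)[symmetric] by (rule left_hull_superset)
    then have "y * inverse x \<in> ?F" if "y \<in> C'" for y
      using that unfolding G_def by blast
    then have "D \<subseteq> ?F" unfolding D_def by (rule image_subsetI)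
    then have "left_hull D \<subseteq> ?F" by (rule left_hull_minimal[OF _ left_submodule_hull])
    moreover have "?F \<subseteq> left_hull D"
    proof
      fix f assume f: "f \<in> ?F"
      have "y * inverse x \<in> left_hull D" if "y \<in> C'" for y
        using subsetD[OF left_hull_superset imageI[OF that]] unfolding D_def .
      then have "C' \<subseteq> {y. y * inverse x \<in> left_hull D}" by (intro subsetI CollectI)
      then have "left_hull C' \<subseteq> {y. y * inverse x \<in> left_hull D}"
        by (rule left_hull_minimal) (rule left_submodule_right_mult_preimage[OF left_submodule_hull])
      moreover have "f * x \<in> left_hull C'" using f x unfolding C'(2) by (simp add: G_def mult.assoc)
      ultimately have "f * x \<in> {y. y * inverse x \<in> left_hull D}" by (rule subsetD)
      then have "f * x * inverse x \<in> left_hull D" by (rule CollectD)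
      then show "f \<in> left_hull D" using x by (simp add: mult.assoc)
    qed
    ultimately have "left_hull D = ?F" by (rule equalityI)
    then have "?P (card D)" using D by (intro exI[of _ D]) simp
    then have "n \<le> card D" unfolding n_def by (rule Least_le[of ?P])
    also have "card D \<le> card C'" unfolding D_def using C' by (intro card_image_le)
    finally show False using C'(3) by linarith
  qed
  then have "f \<in> G" using f by (simp only:)
  then show ?thesis by (simp add: G_def)
qed

lemma left_submodule_sum: "left_submodule F \<Longrightarrow> (\<And>b. b \<in> S \<Longrightarrow> f b \<in> F) \<Longrightarrow> sum f S \<in> F"
  by (intro subspace_sum left_submodule_subspace)

text \<open>A generating set of least size is a basis.\<close>

lemma left_hull_neq_UNIV:
  assumes inf: "left_infinite_dimensional E (UNIV :: 'd set)" and B: "finite B"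
  shows "left_hull B \<noteq> UNIV"
proof
  assume UNIV: "left_hull B = UNIV"
  let ?P = "\<lambda>n. \<exists>C. finite C \<and> left_hull C = UNIV \<and> card C = n"
  define n where "n = (LEAST n. ?P n)"
  have "?P (card B)" using B UNIV by (intro exI[of _ B]) simp
  then have "?P n" unfolding n_def by (rule LeastI[of ?P])
  then obtain C where "finite C \<and> left_hull C = UNIV \<and> card C = n" ..
  then have C: "finite C" "left_hull C = UNIV" "card C = n" by simp_all
  define T where "T = {\<Sum>b\<in>C. c b * b | c. \<forall>b\<in>C. c b \<in> E}"
  have "left_submodule T"
    unfolding left_submodule_def
  proof (intro conjI ballI)
    show "0 \<in> T" using subspace_0[OF subspace_E] by (auto simp: T_def intro!: exI[of _ "\<lambda>_. 0"])
  next
    fix x y assume "x \<in> T" "y \<in> T"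
    then obtain c c' where "x = (\<Sum>b\<in>C. c b * b)" "y = (\<Sum>b\<in>C. c' b * b)" "\<forall>b\<in>C. c b \<in> E" "\<forall>b\<in>C. c' b \<in> E"
      by (auto simp: T_def)
    then show "x + y \<in> T" using subspace_add[OF subspace_E]
      by (auto simp: T_def sum.distrib distrib_right intro!: exI[of _ "\<lambda>b. c b + c' b"])
  next
    fix e x assume "e \<in> E" "x \<in> T"
    then obtain c where "x = (\<Sum>b\<in>C. c b * b)" "\<forall>b\<in>C. c b \<in> E" by (auto simp: T_def)
    then show "e * x \<in> T" using mult_E \<open>e \<in> E\<close>
      by (auto simp: T_def sum_distrib_left mult.assoc intro!: exI[of _ "\<lambda>b. e * c b"])
  qed
  moreover have "C \<subseteq> T"
  proof
    fix a assume "a \<in> C"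
    then have "a = (\<Sum>b\<in>C. (if b = a then 1 else 0) * b)"
      using C by (simp add: if_distrib[of "\<lambda>z. z * _"] sum.delta cong: if_cong)
    then show "a \<in> T" unfolding T_def using one_E subspace_0[OF subspace_E]
      by (intro CollectI exI[of _ "\<lambda>b. if b = a then 1 else 0"]) auto
  qed
  ultimately have "T = UNIV" using C left_hull_minimal by blast
  moreover have "T \<subseteq> left_span E C" using C by (auto simp: T_def left_span_def)
  ultimately have "left_span E C = UNIV" by blast
  moreover have "left_independent E C"
    unfolding left_independent_def
  proof (intro allI impI ballI, rule ccontr)
    fix S c b assume S: "finite S \<and> S \<subseteq> C \<and> (\<forall>b\<in>S. c b \<in> E) \<and> (\<Sum>b\<in>S. c b * b) = 0"
      and b: "b \<in> S" "c b \<noteq> 0"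
    let ?F = "left_hull (C - {b})"
    have bC: "b \<in> C" using S b by auto
    have "(\<Sum>a\<in>S - {b}. c a * a) \<in> ?F"
      using S left_hull_superset[of "C - {b}"] by (intro left_submodule_sum left_submodule_mult left_submodule_hull) auto
    moreover have "c b * b + (\<Sum>a\<in>S - {b}. c a * a) = 0"
      using S sum.remove[OF _ b(1), of "\<lambda>b. c b * b"] by simp
    then have "c b * b = - (\<Sum>a\<in>S - {b}. c a * a)" by (simp add: eq_neg_iff_add_eq_0)
    ultimately have "c b * b \<in> ?F" using subspace_neg[OF left_submodule_subspace[OF left_submodule_hull]] by simp
    moreover have "inverse (c b) \<in> E" using S b inverse_E by blast
    ultimately have 1: "inverse (c b) * (c b * b) \<in> ?F" by (rule left_submodule_mult[OF left_submodule_hull, rotated])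
    have "inverse (c b) * (c b * b) = b" using b(2) by (metis left_inverse mult.assoc mult_1)
    with 1 have "b \<in> ?F" by (simp only:)
    then have "C \<subseteq> ?F" using left_hull_superset[of "C - {b}"] by blast
    then have "?F = UNIV" using C left_hull_minimal[OF _ left_submodule_hull] by blast
    then have "?P (card (C - {b}))" using C by (intro exI[of _ "C - {b}"]) simp
    then have "n \<le> card (C - {b})" unfolding n_def by (rule Least_le[of ?P])
    then show False using bC C card_Diff1_less[of C b] by simp
  qed
  ultimately show False using inf C by (auto simp: left_infinite_dimensional_def left_basis_def)
qed

text \<open>If right multiplication by the generators of \<open>D\<close> preserves the submodule \<open>F\<close>, the stabilizer \<open>Q\<close> of
  \<open>F\<close> is a division subalgebra containing them, so \<open>F\<close> is a nonzero right ideal of \<open>D\<close>.  But then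
  \<open>F\<close> is all of \<open>D\<close>, which is not finitely generated over \<open>E\<close>.\<close>

lemma exists_moving_subframe:
  assumes inf: "left_infinite_dimensional E (UNIV :: 'd set)"
    and fg: finitely_generated_division_algebra
  obtains U where "subframe UNIV U" "moves_submodules U"
proof -
  obtain S where S: "finite S" "division_subalgebra hull S = UNIV"
    using fg by (auto simp: finitely_generated_division_algebra_def)
  define U where "U = span (insert 1 S)"
  have "subframe UNIV U"
    unfolding subframe_def U_def using S by (auto intro: span_base exI[of _ "insert 1 S"])
  moreover have "moves_submodules U"
    unfolding moves_submodules_def
  proof (intro allI impI, rule ccontr)
    fix Z assume Z: "fin_dim Z" "Z \<noteq> {0}" and "\<not> (\<exists>u\<in>U. \<not> (\<lambda>x. x * u) ` Z \<subseteq> left_hull Z)"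
    then have stable: "z * u \<in> left_hull Z" if "u \<in> U" "z \<in> Z" for u z using that by blast
    obtain B where B: "finite B" "span B = Z" using Z by (auto simp: fin_dim_def)
    define F where "F = left_hull B"
    have F: "left_submodule F" by (simp add: F_def left_submodule_hull)
    have "Z \<subseteq> F" unfolding F_def B(2)[symmetric]
      by (intro span_minimal left_hull_superset left_submodule_subspace left_submodule_hull)
    then have ZF: "left_hull Z = F"
      using left_hull_minimal[OF _ F] left_hull_mono[of B Z] span_superset[of B] B by (auto simp: F_def)
    define Q where "Q = {x. \<forall>f\<in>F. f * x \<in> F}"
    have "s \<in> Q" if "s \<in> S" for s
    proof -
      have "s \<in> U" using that by (auto simp: U_def intro: span_base)
      then have "Z \<subseteq> {f. f * s \<in> F}" using stable ZF by auto
      then have "F \<subseteq> {f. f * s \<in> F}" using left_hull_minimal[OF _ left_submodule_right_mult_preimage[OF F], of Z s] ZF by simp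
      then show ?thesis by (auto simp: Q_def)
    qed
    moreover have "division_subalgebra Q"
      unfolding division_subalgebra_def
    proof (intro conjI ballI)
      show "subspace Q"
        using left_submodule_subspace[OF F] unfolding Q_def subspace_def
        by (auto simp: distrib_left scale_mult_right)
      show "1 \<in> Q" by (simp add: Q_def)
      show "x * y \<in> Q" if "x \<in> Q" "y \<in> Q" for x y
        using that by (auto simp: Q_def simp flip: mult.assoc)
      show "inverse x \<in> Q" if "x \<in> Q" for x
      proof (cases "x = 0")
        case False
        then show ?thesis
          using that right_mult_inverse_closed[OF B(1) False] by (auto simp: Q_def F_def)
      qed (use that in simp)
    qed
    ultimately have "Q = UNIV" using S(2) hull_minimal[of S Q division_subalgebra] by blast
    obtain z where z: "z \<in> Z" "z \<noteq> 0" using Z fin_dim_subspace subspace_0 by blast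
    have "d \<in> F" for d
    proof -
      have "z * (inverse z * d) \<in> F" using z \<open>Z \<subseteq> F\<close> \<open>Q = UNIV\<close> by (auto simp: Q_def)
      then show ?thesis using z by (simp flip: mult.assoc)
    qed
    then show False using left_hull_neq_UNIV[OF inf B(1)] by (auto simp: F_def)
  qed
  ultimately show ?thesis using that by blast
qed

section \<open>Growth under left multiplication\<close>

text \<open>Enlarge \<open>H\<close> by one generator after the other, and stop just before the submodule swallows \<open>B\<close>.\<close>

lemma exists_line_quotient_finite:
  assumes "finite B" "left_submodule H" "\<not> B \<subseteq> H"
  shows "\<exists>F w. left_submodule F \<and> H \<subseteq> F \<and> \<not> B \<subseteq> F \<and> B \<subseteq> left_hull (insert w F)"
  using assms
proof (induction B arbitrary: H rule: finite_induct)
  case (insert b B)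
  let ?H' = "left_hull (insert b H)"
  have H': "b \<in> ?H'" "H \<subseteq> ?H'" using left_hull_superset[of "insert b H"] by auto
  show ?case
  proof (cases "B \<subseteq> ?H'")
    case True
    then show ?thesis using insert.prems H' by (intro exI[of _ H] exI[of _ b]) auto
  next
    case False
    then obtain F w where F: "left_submodule F" "?H' \<subseteq> F" "\<not> B \<subseteq> F" "B \<subseteq> left_hull (insert w F)"
      using insert.IH[OF left_submodule_hull False] by (elim exE conjE)
    have "b \<in> left_hull (insert w F)" using left_hull_superset[of "insert w F"] F H' by auto
    then show ?thesis using F H' by (intro exI[of _ F] exI[of _ w]) auto
  qed
qed simp

lemma exists_line_quotient:
  assumes W: "fin_dim W" and H: "left_submodule H" "\<not> W \<subseteq> H"
  obtains F w where "left_submodule F" "H \<subseteq> F" "\<not> W \<subseteq> F" "w \<notin> F" "\<And>x. x \<in> W \<Longrightarrow> \<exists>e\<in>E. x - e * w \<in> F"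
proof -
  obtain B where B: "finite B" "span B = W" using W by (auto simp: fin_dim_def)
  have span: "B \<subseteq> K \<longleftrightarrow> W \<subseteq> K" if "left_submodule K" for K
    using span_minimal[OF _ left_submodule_subspace[OF that], of B] span_superset[of B] B by auto
  obtain F w where F: "left_submodule F" "H \<subseteq> F" "\<not> B \<subseteq> F" "B \<subseteq> left_hull (insert w F)"
    using exists_line_quotient_finite[OF B(1) H(1)] H(2) span[OF H(1)] by metis
  have "W \<subseteq> left_hull (insert w F)" using F(4) span[OF left_submodule_hull] by blast
  then have "\<exists>e\<in>E. x - e * w \<in> F" if "x \<in> W" for x
    using left_hull_insert_mem[OF F(1)] that by blast
  moreover have "w \<notin> F"
    using F(3,4) left_hull_left_submodule[OF F(1)] by (auto simp: insert_absorb)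
  moreover have "\<not> W \<subseteq> F" using F(3) span[OF F(1)] by simp
  ultimately show thesis using F(1,2) that[of F w] by simp
qed

text \<open>A nonzero \<open>P\<close> becomes a subframe after right multiplication by the inverse of one of its elements.\<close>

lemma growth_in_E:
  assumes V: "subframe E V" 
    and VDI: "\<And>W. subframe E W \<Longrightarrow>
      real (dim W) + C * real (dim W) powr ((d - 1) / d) \<le> real (dim (span_prod V W))"
    and P: "fin_dim P" "P \<subseteq> E" "P \<noteq> {0}"
  shows "real (dim P) + C * real (dim P) powr ((d - 1) / d) \<le> real (dim (span_prod V P))"
proof -
  obtain p where p: "p \<in> P" "p \<noteq> 0" using P fin_dim_subspace subspace_0 by blast
  define W where "W = (\<lambda>x. x * inverse p) ` P"
  have Wf: "fin_dim W" unfolding W_def by (rule right_mult_fin_dim[OF P(1)])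
  have "1 \<in> W" using p by (auto simp: W_def intro!: image_eqI[of _ _ p])
  moreover have "W \<subseteq> E" using P(2) p(1) unfolding W_def by (intro image_subsetI mult_E inverse_E) auto
  ultimately have "subframe E W" using Wf by (auto simp: subframe_def fin_dim_def)
  note VDI[OF this]
  moreover have "dim W = dim P" unfolding W_def using P p by (intro dim_right_mult) auto
  moreover have "dim (span_prod V W) \<le> dim (span_prod V P)"
  proof -
    have Vf: "fin_dim V" using V by (auto simp: subframe_def fin_dim_def)
    have VP: "fin_dim (span_prod V P)" by (rule fin_dim_span_prod[OF Vf P(1)])
    let ?S = "(\<lambda>x. x * inverse p) ` span_prod V P"
    have "span_prod V W \<subseteq> ?S"
    proof (rule span_prod_le)
      fix v w assume "v \<in> V" "w \<in> W"
      then obtain x where "x \<in> P" "w = x * inverse p" by (auto simp: W_def)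
      then show "v * w \<in> ?S" using span_prod_mem[OF \<open>v \<in> V\<close>, of x P]
        by (auto simp: mult.assoc intro!: image_eqI[of _ _ "v * x"])
    qed (intro fin_dim_subspace right_mult_fin_dim VP)
    then have "dim (span_prod V W) \<le> dim ?S" by (intro dim_subset_fin_dim right_mult_fin_dim VP)
    also have "dim ?S = dim (span_prod V P)" using p by (intro dim_right_mult VP) auto
    finally show ?thesis .
  qed
  ultimately show ?thesis by simp
qed

text \<open>As \<open>w\<close> is not in \<open>F\<close>, no nonzero multiple of \<open>w\<close> by an element of \<open>E\<close> is.\<close>

lemma dim_mod_line:
  assumes P: "fin_dim P" "P \<subseteq> E" and F: "left_submodule F" "w \<notin> F"
  shows "dim_mod ((\<lambda>p. p * w) ` P) F = dim P"
proof -
  let ?L = "(\<lambda>p. p * w) ` P"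
  have L: "fin_dim ?L" by (rule right_mult_fin_dim[OF P(1)])
  have "?L \<inter> F = {0}"
  proof (intro equalityI subsetI)
    fix y assume "y \<in> ?L \<inter> F"
    then obtain p where p: "p \<in> P" "y = p * w" "y \<in> F" by auto
    have "p = 0"
    proof (rule ccontr)
      assume "p \<noteq> 0"
      have "inverse p \<in> E" using p P inverse_E by blast
      then have "inverse p * (p * w) \<in> F" using p left_submodule_mult[OF F(1)] by simp
      moreover have "inverse p * (p * w) = w" using \<open>p \<noteq> 0\<close> by (simp flip: mult.assoc)
      ultimately show False using F by simp
    qed
    then show "y \<in> {0}" using p by simp
  qed (use L F subspace_0 fin_dim_subspace left_submodule_subspace in blast)
  moreover have "dim {0} = 0" using dim_eq_0_fin_dim[of "{0}"] fin_dim_span[of "{}"] by simp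
  moreover have "w \<noteq> 0" using F subspace_0 left_submodule_subspace by blast
  ultimately show ?thesis using dim_right_mult[OF P(1)] by (simp add: dim_mod_def)
qed

text \<open>\<open>W\<close> lies on the line \<open>E w\<close> modulo \<open>F\<close>; the coordinates with respect to \<open>w\<close> of its elements form
  a subspace \<open>P\<close> of \<open>E\<close> isomorphic to the image of \<open>W\<close> in the quotient by \<open>F\<close>.\<close>

lemma line_coordinates:
  assumes W: "fin_dim W" and F: "left_submodule F" "\<not> W \<subseteq> F" and wF: "w \<notin> F"
    and w: "\<And>x. x \<in> W \<Longrightarrow> \<exists>e\<in>E. x - e * w \<in> F"
  obtains P where "fin_dim P" "P \<subseteq> E" "P \<noteq> {0}" "dim P = dim_mod W F"
    "\<And>p. p \<in> P \<Longrightarrow> \<exists>x\<in>W. p * w - x \<in> F"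
proof -
  have sub: "subspace W" "subspace F" using W F fin_dim_subspace left_submodule_subspace by auto
  obtain B where B: "finite B" "span B = W" using W by (auto simp: fin_dim_def)
  have BW: "B \<subseteq> W" using B span_superset by blast
  then have "\<forall>b\<in>B. \<exists>e. e \<in> E \<and> b - e * w \<in> F" using w by blast
  then obtain c where c: "\<And>b. b \<in> B \<Longrightarrow> c b \<in> E" "\<And>b. b \<in> B \<Longrightarrow> b - c b * w \<in> F" by metis
  define P where "P = span (c ` B)"
  have P: "fin_dim P" unfolding P_def using B by (intro fin_dim_span) auto
  have PE: "P \<subseteq> E" unfolding P_def using c subspace_E by (intro span_minimal) auto
  let ?L = "(\<lambda>p. p * w) ` P"
  have L: "fin_dim ?L" by (rule right_mult_fin_dim[OF P])
  have "c ` B \<subseteq> {p. p * w \<in> span (W \<union> F)}"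
  proof clarify
    fix b assume b: "b \<in> B"
    have "c b * w = b + - (b - c b * w)" by simp
    moreover have "- (b - c b * w) \<in> F" using c b sub subspace_neg by blast
    ultimately show "c b * w \<in> span (W \<union> F)" using b BW unfolding span_Un_mem[OF sub] by blast
  qed
  then have "P \<subseteq> {p. p * w \<in> span (W \<union> F)}"
    unfolding P_def by (intro span_minimal subspace_right_mult_preimage subspace_span)
  then have PW: "\<exists>x\<in>W. p * w - x \<in> F" if "p \<in> P" for p
    using that sub unfolding span_Un_mem[OF sub] by force
  have "B \<subseteq> span (?L \<union> F)"
  proof
    fix b assume b: "b \<in> B"
    have "b = c b * w + (b - c b * w)" by simp
    moreover have "c b * w \<in> ?L" using b by (auto simp: P_def intro: span_base)
    ultimately show "b \<in> span (?L \<union> F)"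
      using c(2)[OF b] unfolding span_Un_mem[OF fin_dim_subspace[OF L] sub(2)] by blast
  qed
  then have "W \<subseteq> span (?L \<union> F)" unfolding B(2)[symmetric] by (intro span_minimal subspace_span)
  then have WP: "\<exists>y\<in>?L. x - y \<in> F" if "x \<in> W" for x
    using that unfolding subset_iff span_Un_mem[OF fin_dim_subspace[OF L] sub(2)] by force
  have "dim_mod ?L F = dim P" by (rule dim_mod_line[OF P PE F(1) wF])
  moreover have "dim_mod ?L F = dim_mod W F"
    using WP PW L W sub by (intro antisym dim_mod_le) auto
  ultimately have dim: "dim P = dim_mod W F" by simp
  moreover have "P \<noteq> {0}"
    using dim dim_mod_pos[OF W sub(2) F(2)] dim_eq_0_fin_dim[OF P] by auto
  ultimately show thesis using that P PE PW by blast
qed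

text \<open>Peel off a quotient of dimension at most \<open>t\<close> lying on a line, modulo \<open>F\<close>, and apply induction to the
  rest \<open>W \<inter> F\<close>.  As \<open>F\<close> is stable under \<open>V\<close>, the growth of the rest happens inside \<open>F\<close>, and that of
  the quotient outside of it.\<close>

lemma growth_left:
  assumes V: "subframe E V" and C: "0 < C" and d: "0 < d" and t: "0 < t"
    and VDI: "\<And>W. subframe E W \<Longrightarrow>
      real (dim W) + C * real (dim W) powr ((d - 1) / d) \<le> real (dim (span_prod V W))"
    and W: "fin_dim W"
    and thin: "\<And>Z. subspace Z \<Longrightarrow> Z \<subseteq> W \<Longrightarrow> Z \<noteq> {0} \<Longrightarrow> \<not> thick (Suc t) Z"
  shows "real (dim W) + C * real (dim W) * real t powr (- 1 / d) \<le> real (dim (span_prod V W))"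
  using W thin
proof (induction "dim W" arbitrary: W rule: less_induct)
  case less
  note W = \<open>fin_dim W\<close>
  have Vf: "fin_dim V" and VE: "V \<subseteq> E" using V by (auto simp: subframe_def fin_dim_def)
  show ?case
  proof (cases "W = {0}")
    case True
    then have "dim W = 0" using dim_eq_0_fin_dim[OF W] by simp
    then show ?thesis by simp
  next
    case False
    then have "\<not> thick (Suc t) W" using less.prems fin_dim_subspace by blast
    then obtain H where H: "left_submodule H" "\<not> W \<subseteq> H" "dim_mod W H \<le> t"
      unfolding thick_def by (metis not_less_eq_eq)
    obtain F w where F: "left_submodule F" "H \<subseteq> F" "\<not> W \<subseteq> F" "w \<notin> F"
        "\<And>x. x \<in> W \<Longrightarrow> \<exists>e\<in>E. x - e * w \<in> F"
      using exists_line_quotient[OF W H(1,2)] by blast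
    have sF: "subspace F" using F left_submodule_subspace by blast
    obtain P where P: "fin_dim P" "P \<subseteq> E" "P \<noteq> {0}" "dim P = dim_mod W F"
      "\<And>p. p \<in> P \<Longrightarrow> \<exists>x\<in>W. p * w - x \<in> F"
      using line_coordinates[OF W F(1,3,4,5)] by blast
    let ?n = "dim P"
    have n: "1 \<le> ?n" "?n \<le> t"
      using dim_mod_pos[OF W sF F(3)] dim_mod_anti[OF W sF F(2)] H P(4) by auto
    have "real ?n * real t powr (- 1 / d) \<le> real ?n powr ((d - 1) / d)"
    proof -
      have "real ?n powr ((d - 1) / d) = real ?n powr (1 + - 1 / d)" using d by (simp add: field_simps)
      also have "\<dots> = real ?n * real ?n powr (- 1 / d)" using n by (subst powr_add) simp
      also have "\<dots> \<ge> real ?n * real t powr (- 1 / d)"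
        using n d by (intro mult_left_mono powr_mono2') auto
      finally show ?thesis .
    qed
    then have "C * (real ?n * real t powr (- 1 / d)) \<le> C * real ?n powr ((d - 1) / d)"
      using C by (intro mult_left_mono) auto
    then have 1: "real ?n + C * real ?n * real t powr (- 1 / d) \<le> real (dim (span_prod V P))"
      using growth_in_E[OF V VDI P(1-3)] by (simp add: mult.assoc)
    let ?R = "span_prod V W" and ?W' = "W \<inter> F"
    have R: "fin_dim ?R" by (rule fin_dim_span_prod[OF Vf W])
    have W': "fin_dim ?W'" using W sF by (rule fin_dim_Int)
    have dW: "dim W = dim ?W' + ?n" using dim_split[OF W sF] P(4) by simp
    have 2: "real (dim ?W') + C * real (dim ?W') * real t powr (- 1 / d) \<le> real (dim (span_prod V ?W'))"
      using less.hyps[of ?W'] W' dW n less.prems by auto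
    have "span_prod V ?W' \<subseteq> ?R \<inter> F"
    proof (rule span_prod_le)
      show "subspace (?R \<inter> F)" using R sF fin_dim_subspace subspace_inter by blast
      show "v * x \<in> ?R \<inter> F" if "v \<in> V" "x \<in> ?W'" for v x
        using that VE F left_submodule_mult span_prod_mem by auto
    qed
    then have 3: "dim (span_prod V ?W') \<le> dim (?R \<inter> F)"
      using R sF by (intro dim_subset_fin_dim fin_dim_Int)
    have "dim (span_prod V P) \<le> dim_mod ?R F"
    proof -
      let ?Q = "span_prod V P"
      let ?L = "(\<lambda>p. p * w) ` ?Q"
      have Q: "fin_dim ?Q" by (rule fin_dim_span_prod[OF Vf P(1)])
      have L: "fin_dim ?L" by (rule right_mult_fin_dim[OF Q])
      have sR: "subspace ?R" using R by (rule fin_dim_subspace)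
      have "?Q \<subseteq> {q. q * w \<in> span (?R \<union> F)}"
      proof (rule span_prod_le)
        fix v p assume v: "v \<in> V" and p: "p \<in> P"
        obtain x where x: "x \<in> W" "p * w - x \<in> F" using P(5)[OF p] by blast
        have "v * (p * w - x) \<in> F" using F(1) VE v x by (intro left_submodule_mult) auto
        moreover have "v * p * w = v * x + v * (p * w - x)" by (simp add: algebra_simps)
        ultimately have "v * p * w \<in> span (?R \<union> F)"
          using span_prod_mem[OF v x(1)] unfolding span_Un_mem[OF sR sF] by blast
        then show "v * p \<in> {q. q * w \<in> span (?R \<union> F)}" by simp
      qed (intro subspace_right_mult_preimage subspace_span)
      then have QR: "\<exists>r\<in>?R. y - r \<in> F" if "y \<in> ?L" for y
        using that unfolding span_Un_mem[OF sR sF] by force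
      have QE: "?Q \<subseteq> E" using VE P(2) by (intro span_prod_le mult_E subspace_E) auto
      have "dim_mod ?L F = dim ?Q" using dim_mod_line[OF Q QE F(1,4)] .
      moreover have "dim_mod ?L F \<le> dim_mod ?R F" using QR by (intro dim_mod_le L R sF) auto
      ultimately show ?thesis by simp
    qed
    then have "real (dim ?R) \<ge> real (dim (span_prod V ?W')) + real (dim (span_prod V P))"
      using dim_split[OF R sF] 3 by linarith
    then show ?thesis using 1 2 unfolding dW by (simp add: algebra_simps)
  qed
qed

section \<open>The transcendence degrees\<close>

lemma exists_maximal_thickness:
  assumes W: "fin_dim W" "W \<noteq> {0}"
  obtains t Z where "0 < t" "subspace Z" "Z \<subseteq> W" "Z \<noteq> {0}" "thick t Z"
    "\<And>Z. subspace Z \<Longrightarrow> Z \<subseteq> W \<Longrightarrow> Z \<noteq> {0} \<Longrightarrow> \<not> thick (Suc t) Z"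
proof -
  define A where "A = {t. \<exists>Z. subspace Z \<and> Z \<subseteq> W \<and> Z \<noteq> {0} \<and> thick t Z}"
  have "A \<subseteq> {..dim W}"
  proof
    fix t assume "t \<in> A"
    then obtain Z where Z: "subspace Z" "Z \<subseteq> W" "Z \<noteq> {0}" "thick t Z" by (auto simp: A_def)
    have "\<not> Z \<subseteq> {0}" using Z subspace_0 by blast
    then have "t \<le> dim_mod Z {0}" using Z(4) left_submodule_0 by (auto simp: thick_def)
    also have "\<dots> \<le> dim Z" by (simp add: dim_mod_def)
    also have "\<dots> \<le> dim W" by (rule dim_subset_fin_dim[OF W(1) Z(2)])
    finally show "t \<in> {..dim W}" by simp
  qed
  then have fin: "finite A" using finite_subset by blast
  have "thick 1 W"
    unfolding thick_def using dim_mod_pos[OF W(1)] left_submodule_subspace by blast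
  then have "1 \<in> A" using W fin_dim_subspace by (auto simp: A_def)
  then have max: "Max A \<in> A" "1 \<le> Max A" using fin by (auto intro: Max_in Max_ge)
  have "Suc (Max A) \<notin> A" using Max_ge[OF fin, of "Suc (Max A)"] by auto
  then have "\<not> thick (Suc (Max A)) Z" if "subspace Z" "Z \<subseteq> W" "Z \<noteq> {0}" for Z
    using that by (auto simp: A_def)
  moreover obtain Z where "subspace Z" "Z \<subseteq> W" "Z \<noteq> {0}" "thick (Max A) Z"
    using max(1) unfolding A_def by blast
  ultimately show thesis using that[of "Max A" Z] max(2) by simp
qed

lemma subframe_fin_dim: "subframe A V \<Longrightarrow> fin_dim V"
  by (auto simp: subframe_def fin_dim_def)

text \<open>The threshold \<open>x\<close> for the maximal thickness \<open>t\<close> balances the two gains: \<open>n * x powr (- 1 / d) = x\<close> for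
  \<open>x = n powr (d / (d + 1))\<close>.\<close>

lemma two_sided_growth:
  assumes V: "subframe E V" and C: "0 < C" and d: "0 < d"
    and VDI: "\<And>W. subframe E W \<Longrightarrow>
      real (dim W) + C * real (dim W) powr ((d - 1) / d) \<le> real (dim (span_prod V W))"
    and U: "subframe UNIV U" "moves_submodules U"
    and W: "subframe UNIV W"
  shows "real (dim W) + min 1 C * real (dim W) powr (d / (d + 1))
    \<le> max (real (dim (span_prod (span (V \<union> U)) W))) (real (dim (span_prod W (span (V \<union> U)))))"
proof -
  let ?V' = "span (V \<union> U)" and ?n = "dim W"
  have fd: "fin_dim V" "fin_dim U" "fin_dim W" using V U W subframe_fin_dim by auto
  have V': "fin_dim ?V'" using fd by (intro fin_dim_span_Un)
  have "1 \<in> W" "1 \<in> U" using W U by (auto simp: subframe_def)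
  then have W0: "W \<noteq> {0}" by auto
  then have n: "0 < ?n" using dim_eq_0_fin_dim[OF fd(3)] by auto
  obtain t Z where t: "0 < t" "subspace Z" "Z \<subseteq> W" "Z \<noteq> {0}" "thick t Z"
    "\<And>Z. subspace Z \<Longrightarrow> Z \<subseteq> W \<Longrightarrow> Z \<noteq> {0} \<Longrightarrow> \<not> thick (Suc t) Z"
    using exists_maximal_thickness[OF fd(3) W0] by metis
  define x where "x = real ?n powr (d / (d + 1))"
  have x: "0 < x" using n by (simp add: x_def)
  show ?thesis
  proof (cases "x \<le> real t")
    case True
    have "?n + t \<le> dim (span_prod W U)"
      by (rule growth_right[OF fd(3,2) \<open>1 \<in> U\<close> U(2) t(2-5)])
    also have "\<dots> \<le> dim (span_prod W ?V')"
      using span_superset[of "V \<union> U"]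
      by (intro dim_subset_fin_dim fin_dim_span_prod fd V' span_prod_mono) auto
    finally have "real ?n + x \<le> real (dim (span_prod W ?V'))" using True by linarith
    moreover have "min 1 C * x \<le> x" using x by (simp add: mult_left_le_one_le)
    ultimately show ?thesis by (simp add: x_def)
  next
    case False
    have "x powr (- 1 / d) \<le> real t powr (- 1 / d)"
      using False t(1) d by (intro powr_mono2') auto
    moreover have "x powr (- 1 / d) = real ?n powr (- 1 / (d + 1))"
      using d by (simp add: x_def powr_powr)
    moreover have "real ?n * real ?n powr (- 1 / (d + 1)) = x"
    proof -
      have "x = real ?n powr (1 + - 1 / (d + 1))" unfolding x_def using d by (simp add: field_simps)
      also have "\<dots> = real ?n * real ?n powr (- 1 / (d + 1))" using n by (subst powr_add) simp
      finally show ?thesis by simp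
    qed
    ultimately have "x \<le> real ?n * real t powr (- 1 / d)"
      by (metis mult_left_mono of_nat_0_le_iff)
    then have "C * x \<le> C * real ?n * real t powr (- 1 / d)"
      using C by (simp add: mult.assoc)
    moreover have "min 1 C * x \<le> C * x" using x by (intro mult_right_mono) auto
    moreover have "real ?n + C * real ?n * real t powr (- 1 / d) \<le> real (dim (span_prod V W))"
      by (rule growth_left[OF V C d t(1) VDI fd(3) t(6)])
    moreover have "dim (span_prod V W) \<le> dim (span_prod ?V' W)"
      using span_superset[of "V \<union> U"]
      by (intro dim_subset_fin_dim fin_dim_span_prod fd V' span_prod_mono) auto
    ultimately show ?thesis by (simp add: x_def)
  qed
qed

text \<open>The exponent \<open>1\<close> asks for growth by a constant, and thickness at least \<open>1\<close> is always available.\<close>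

lemma Ld_star_ge_one:
  assumes U: "subframe UNIV U" "moves_submodules U"
  shows "1 \<le> Ld_star (UNIV :: 'd set)"
proof -
  have "real (dim W) + 1 * real (dim W) powr ((1 - 1) / 1)
      \<le> max (real (dim (span_prod U W))) (real (dim (span_prod W U)))" if W: "subframe UNIV W" for W
  proof -
    have fd: "fin_dim W" "fin_dim U" "1 \<in> U" "1 \<in> W"
      using U W subframe_fin_dim by (auto simp: subframe_def)
    then have W0: "W \<noteq> {0}" by auto
    obtain t Z where t: "0 < t" "subspace Z" "Z \<subseteq> W" "Z \<noteq> {0}" "thick t Z"
      using exists_maximal_thickness[OF fd(1) W0] by metis
    have "dim W + t \<le> dim (span_prod W U)"
      by (rule growth_right[OF fd(1-3) U(2) t(2-5)])
    moreover have "dim W \<noteq> 0" using W0 dim_eq_0_fin_dim[OF fd(1)] by simp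
    ultimately show ?thesis using t(1) by simp
  qed
  then have "ennreal 1 \<le> VDI_star UNIV U"
    unfolding VDI_star_def
    by (intro Sup_upper CollectI exI[of _ 1] conjI allI impI) (auto intro!: exI[of _ 1])
  also have "\<dots> \<le> Ld_star UNIV" unfolding Ld_star_def using U by (intro SUP_upper) simp
  finally show ?thesis by simp
qed

lemma Ld_star_ge_plus_one:
  assumes V: "subframe E V" and C: "0 < C" and d: "0 < d"
    and VDI: "\<And>W. subframe E W \<Longrightarrow>
      real (dim W) + C * real (dim W) powr ((d - 1) / d) \<le> real (dim (span_prod V W))"
    and U: "subframe UNIV U" "moves_submodules U"
  shows "ennreal d + 1 \<le> Ld_star (UNIV :: 'd set)"
proof -
  let ?V' = "span (V \<union> U)"
  have fd: "fin_dim V" "fin_dim U" using V U subframe_fin_dim by auto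
  have "subframe UNIV ?V'"
    using fin_dim_span_Un[OF fd] U by (auto simp: subframe_def fin_dim_def intro: span_base)
  then have "VDI_star UNIV ?V' \<le> Ld_star (UNIV :: 'd set)"
    unfolding Ld_star_def by (intro SUP_upper) simp
  moreover have "ennreal (d + 1) \<le> VDI_star UNIV ?V'"
  proof -
    have "real (dim W) + min 1 C * real (dim W) powr ((d + 1 - 1) / (d + 1))
        \<le> max (real (dim (span_prod ?V' W))) (real (dim (span_prod W ?V')))"
      if "subframe UNIV W" for W
      using two_sided_growth[OF V C d VDI U that] by simp
    then have ex: "\<exists>C>0. \<forall>W. subframe UNIV W \<longrightarrow>
        max (real (dim (span_prod ?V' W))) (real (dim (span_prod W ?V')))
          \<ge> real (dim W) + C * real (dim W) powr ((d + 1 - 1) / (d + 1))"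
      using C by (intro exI[of _ "min 1 C"]) simp
    show ?thesis
      unfolding VDI_star_def
      by (rule Sup_upper, rule CollectI, rule exI[of _ "d + 1"]) (use ex d in simp)
  qed
  moreover have "ennreal (d + 1) = ennreal d + 1" using d by simp
  ultimately show ?thesis by simp
qed

end

theorem theorem4p6:
  fixes scale :: "'k::field \<Rightarrow> 'd::division_ring \<Rightarrow> 'd"
    and E :: "'d set"
  assumes "division_algebra scale"
    and "division_algebra.finitely_generated_division_algebra scale"
    and "division_algebra.division_subalgebra scale E"
    and "left_infinite_dimensional E (UNIV :: 'd set)"
  shows "domain_algebra.Ld_star scale (UNIV :: 'd set) \<ge> domain_algebra.Ld scale E + 1"
proof -
  interpret division_algebra scale by fact
  interpret division_extension scale E by unfold_locales fact
  obtain U where U: "subframe UNIV U" "moves_submodules U"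
    using exists_moving_subframe[OF assms(4,2)] .
  let ?L = "Ld_star (UNIV :: 'd set)"
  have "Ld E \<le> ?L - 1"
    unfolding Ld_def VDI_def
  proof (intro SUP_least Sup_least)
    fix V y assume V: "V \<in> {V. subframe E V}" and "y \<in> {ennreal d |d. d > 0 \<and> (\<exists>C>0. \<forall>W. subframe E W \<longrightarrow>
        real (dim (span_prod V W)) \<ge> real (dim W) + C * real (dim W) powr ((d - 1) / d))}"
    then obtain d C where "y = ennreal d" "d > 0" "C > 0" "\<And>W. subframe E W \<Longrightarrow>
        real (dim W) + C * real (dim W) powr ((d - 1) / d) \<le> real (dim (span_prod V W))" by blast
    then have "y + 1 \<le> ?L" using Ld_star_ge_plus_one[of V C d U] U V by auto
    then have "y + 1 - 1 \<le> ?L - 1" by (intro ennreal_minus_mono) auto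
    then show "y \<le> ?L - 1" by simp
  qed
  then have "Ld E + 1 \<le> ?L - 1 + 1" by (rule add_right_mono)
  also have "\<dots> = ?L" using Ld_star_ge_one[OF U] by (intro diff_add_cancel_ennreal)
  finally show ?thesis .
qed

end
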